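(* Let $A$ be a generalized Cartan matrix with Dynkin diagram $\Gamma$ and vertex set indexed by $I$, let $E$ be a simply folded full heap over $\Gamma$, let $W=W(\Gamma)$ be the Weyl group of $\Gamma$ with generators $s_i$ ($i\in I$), and let $k$ be a field of characteristic different from $2$. Let $V_E$ be the $k$-vector space with basis $\{v_J: J\text{ a proper ideal of }E\}$ and let $S_i$ be the linear operator on $V_E$ with $S_i(v_J)=Y_i(v_J)$ if $Y_i(v_J)\ne0$, $S_i(v_J)=X_i(v_J)$ if $X_i(v_J)\neq0$, and $S_i(v_J)=v_J$ otherwise. (i) The assignment $s_i\mapsto -S_i$ defines a unique (left) $kW$-module structure on $V_E$. (ii) If $s_i,s_j$ are a pair of noncommuting generators of $W$ and the subgroup $W_{ij}=\langle s_i,s_j\rangle$ of $W$ they generate is finite, then the element $\sum_{w\in W_{ij}}w$ of $kW$ annihilates $V_E$. (iii) The $kW$-module $V_E$ is cyclic, and any of the basis elements $v_J$ is a generator.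
   Context: All generalized Cartan matrices have entries in $\{2,0,-1,-2\}$: $a_{ii}=2$, $a_{ij}\le0$ for $i\neq j$, $a_{ij}=0\iff a_{ji}=0$; simply laced means entries in $\{2,0,-1\}$. In the Dynkin diagram, whose vertices index the rows, distinct $p,q$ are adjacent iff $a_{pq}\ne0$ (with an arrow pointing towards $p$ if $a_{pq}=-2$). The Weyl group $W(\Gamma)$ is generated by $s_i$ ($i\in I$) with relations $s_i^2=1$; $s_is_j=s_js_i$ if $a_{ij}=0$; $s_is_js_i=s_js_is_j$ if $a_{ij}<0$ and $a_{ij}a_{ji}=1$; $s_is_js_is_j=s_js_is_js_i$ if $a_{ij}<0$ and $a_{ij}a_{ji}=2$ (no relation is added if $a_{ij}a_{ji}=4$, $i\ne j$). Labelled heap over $\Gamma$: $(E,\le,\varepsilon)$ with $(E,\le)$ a locally finite poset and $\varepsilon$ a map from $E$ to the vertices such that (1) $\alpha,\beta$ are comparable whenever their labels are equal or adjacent; (2) $\le$ is the transitive closure of "$\alpha\le\beta$ and the labels of $\alpha,\beta$ are equal or adjacent". A heap is an isomorphism class of labelled heaps (work with a representative). $E$ is fibred if (a) each $\varepsilon^{-1}(p)$ is unbounded above and below, and (b) for adjacent $p,p'$ and $\varepsilon(\alpha)=p$ there is $\beta$ with $\varepsilon(\beta)=p'$ such that $\alpha$ covers $\beta$ or $\beta$ covers $\alpha$. $E$ is full if it is fibred and every open interval $(\alpha,\beta)$ with $\varepsilon(\alpha)=\varepsilon(\beta)=p$ and containing no element labelled $p$ satisfies $\sum_{\gamma\in(\alpha,\beta)}a_{p,\varepsilon(\gamma)}=-2$.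 An ideal is a downward closed subset; it is proper if it is nonempty, not all of $E$, and meets each $\varepsilon^{-1}(p)$ in a nonempty proper subset. Folding. Let $B$ be simply laced of untwisted affine type (Kac's types $X_l^{(1)}$) with Dynkin diagram $\Gamma'$, and $\mu$ a graph automorphism of $\Gamma'$ of order exactly $2$ such that $p$ and $\mu(p)$ are never distinct adjacent vertices. Let $f(p)=\bar p$ be the $\mu$-orbit of $p$. Define $\overline B$, with diagram $\overline{\Gamma'}$, indexed by orbits: $\bar b_{\bar p\bar p}=2$; for $\bar p\ne\bar q$, $\bar b_{\bar p\bar q}=0$ if no element of $\bar p$ is adjacent to an element of $\bar q$, $-2$ if $p\ne\mu(p)$ and an element of $\bar q$ is adjacent to both $p$ and $\mu(p)$, and $-1$ otherwise. Let $E'=(E',\le,\varepsilon)$ be a full labelled heap over $\Gamma'$ such that whenever $\mu(p)$ and $q$ are equal or adjacent, every $\alpha\in\varepsilon^{-1}(p)$ and $\beta\in\varepsilon^{-1}(q)$ are comparable. Then $\overline{E'}=(E',\le,f\circ\varepsilon)$ is a full heap over $\overline{\Gamma'}$. A full heap $E$ over the diagram $\Gamma$ of a matrix $A$ of untwisted affine type is simply folded if either $A$ is simply laced (and $E$ is any full heap over $\Gamma$), or $A$ is not simply laced and there exist a simply laced $B$ of untwisted affine type with Dynkin diagram $\Gamma'$, a graph automorphism $\mu$ of $\Gamma'$ of order exactly $2$ such that $p$ and $\mu(p)$ are never distinct adjacent vertices, and a full labelled heap $E'=(E',\le,\varepsilon)$ over $\Gamma'$ such that all $\alpha\in\varepsilon^{-1}(p)$,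 $\beta\in\varepsilon^{-1}(q)$ are comparable whenever $\mu(p)$ and $q$ are equal or adjacent, with $A=\overline B$ and $E=\overline{E'}$. Operators. $X_p(v_J)=v_{J\cup\{\alpha\}}$ if there is a (unique) $\alpha\in E\setminus J$ labelled $p$ with $J\cup\{\alpha\}$ an ideal, else $0$; $Y_p(v_J)=v_{J\setminus\{\alpha\}}$ if there is a (unique) $\alpha\in J$ labelled $p$ with $J\setminus\{\alpha\}$ an ideal, else $0$. Fullness ensures that $X_p(v_J)$ and $Y_p(v_J)$ are not both nonzero. *)

theory Defs
  imports
    "HOL-Algebra.Generated_Groups"
    "HOL-Algebra.Ring"
    "HOL-Library.Poly_Mapping"
    "HOL-Library.FuncSet"
begin

section \<open>Generalized Cartan matrices and Dynkin diagrams\<close>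

text \<open>A matrix is a function \<open>a\<close> together with a finite index set \<open>I\<close>; entries outside
  \<open>I\<close> are irrelevant.\<close>

definition gcm :: "'i set \<Rightarrow> ('i \<Rightarrow> 'i \<Rightarrow> int) \<Rightarrow> bool" where
  "gcm I a \<longleftrightarrow> finite I \<and> (\<forall>i\<in>I. a i i = 2) \<and>
     (\<forall>i\<in>I. \<forall>j\<in>I. i \<noteq> j \<longrightarrow> a i j \<in> {0, -1, -2} \<and> (a i j = 0 \<longleftrightarrow> a j i = 0))"

definition simply_laced :: "'i set \<Rightarrow> ('i \<Rightarrow> 'i \<Rightarrow> int) \<Rightarrow> bool" where
  "simply_laced I a \<longleftrightarrow> (\<forall>i\<in>I. \<forall>j\<in>I. a i j \<in> {2, 0, -1})"

definition adjacent :: "'i set \<Rightarrow> ('i \<Rightarrow> 'i \<Rightarrow> int) \<Rightarrow> 'i \<Rightarrow> 'i \<Rightarrow> bool" where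
  "adjacent I a p q \<longleftrightarrow> p \<in> I \<and> q \<in> I \<and> p \<noteq> q \<and> a p q \<noteq> 0"

text \<open>The matrix of the diagram with edge set \<open>S\<close> (each edge listed in one orientation) in which
  \<open>(p, q) \<in> T\<close> means that the edge between \<open>p\<close> and \<open>q\<close> carries an arrow towards \<open>p\<close>.\<close>

definition diagram_matrix :: "(nat \<times> nat) set \<Rightarrow> (nat \<times> nat) set \<Rightarrow> nat \<Rightarrow> nat \<Rightarrow> int" where
  "diagram_matrix S T p q =
     (if p = q then 2
      else if (p, q) \<in> T then -2
      else if (p, q) \<in> S \<or> (q, p) \<in> S then -1
      else 0)"

text \<open>Kac's Table Aff 1, vertices \<open>{0..l}\<close>: \<open>affine_table l b\<close> says that \<open>b\<close> is the matrix of
  a type with \<open>l + 1\<close> vertices. The type \<open>G\<^sub>2\<close>, whose matrix has an entry \<open>-3\<close>, is excluded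
  by the standing restriction on matrix entries.\<close>

inductive affine_table :: "nat \<Rightarrow> (nat \<Rightarrow> nat \<Rightarrow> int) \<Rightarrow> bool" where
  A1: "affine_table 1 (diagram_matrix {(0,1)} {(0,1), (1,0)})"
| A: "l \<ge> 2 \<Longrightarrow> affine_table l (diagram_matrix ({(i, Suc i) |i. i < l} \<union> {(l,0)}) {})"
| B: "l \<ge> 3 \<Longrightarrow> affine_table l
       (diagram_matrix ({(i, Suc i) |i. 1 \<le> i \<and> i < l} \<union> {(0,2)}) {(l, l - 1)})"
| C: "l \<ge> 2 \<Longrightarrow> affine_table l
       (diagram_matrix {(i, Suc i) |i. i < l} {(1, 0), (l - 1, l)})"
| D: "l \<ge> 4 \<Longrightarrow> affine_table l
       (diagram_matrix ({(i, Suc i) |i. 1 \<le> i \<and> i < l - 1} \<union> {(0,2), (l - 2, l)}) {})"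
| E6: "affine_table 6 (diagram_matrix {(1,2), (2,3), (3,4), (4,5), (3,6), (6,0)} {})"
| E7: "affine_table 7 (diagram_matrix {(0,1), (1,2), (2,3), (3,4), (4,5), (5,6), (3,7)} {})"
| E8: "affine_table 8
       (diagram_matrix {(0,1), (1,2), (2,3), (3,4), (4,5), (5,6), (6,7), (5,8)} {})"
| F4: "affine_table 4 (diagram_matrix {(0,1), (1,2), (2,3), (3,4)} {(3,2)})"

definition untwisted_affine :: "'i set \<Rightarrow> ('i \<Rightarrow> 'i \<Rightarrow> int) \<Rightarrow> bool" where
  "untwisted_affine I a \<longleftrightarrow>
     (\<exists>l b \<phi>. affine_table l b \<and> bij_betw \<phi> {0..l} I \<and>
        (\<forall>i\<in>{0..l}. \<forall>j\<in>{0..l}. a (\<phi> i) (\<phi> j) = b i j))"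

section \<open>Heaps\<close>

text \<open>The poset \<open>E\<close> is (the universe of) a type of class \<^class>\<open>order\<close>.\<close>

definition labelled_heap :: "'i set \<Rightarrow> ('i \<Rightarrow> 'i \<Rightarrow> int) \<Rightarrow> ('e::order \<Rightarrow> 'i) \<Rightarrow> bool" where
  "labelled_heap I a \<epsilon> \<longleftrightarrow>
     (\<forall>\<alpha> \<beta> :: 'e. finite {\<alpha>..\<beta>}) \<and>
     range \<epsilon> \<subseteq> I \<and>
     (\<forall>\<alpha> \<beta>. \<epsilon> \<alpha> = \<epsilon> \<beta> \<or> adjacent I a (\<epsilon> \<alpha>) (\<epsilon> \<beta>) \<longrightarrow> \<alpha> \<le> \<beta> \<or> \<beta> \<le> \<alpha>) \<and>
     (\<le>) = (\<lambda>\<alpha> \<beta>. \<alpha> \<le> \<beta> \<and> (\<epsilon> \<alpha> = \<epsilon> \<beta> \<or> adjacent I a (\<epsilon> \<alpha>) (\<epsilon> \<beta>)))\<^sup>+\<^sup>+"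

definition covers :: "'e::order \<Rightarrow> 'e \<Rightarrow> bool" where
  "covers \<alpha> \<beta> \<longleftrightarrow> \<beta> < \<alpha> \<and> {\<beta><..<\<alpha>} = {}"

definition fibred_heap :: "'i set \<Rightarrow> ('i \<Rightarrow> 'i \<Rightarrow> int) \<Rightarrow> ('e::order \<Rightarrow> 'i) \<Rightarrow> bool" where
  "fibred_heap I a \<epsilon> \<longleftrightarrow> labelled_heap I a \<epsilon> \<and>
     (\<forall>p\<in>I. \<not> bdd_above (\<epsilon> -` {p}) \<and> \<not> bdd_below (\<epsilon> -` {p})) \<and>
     (\<forall>p p' \<alpha>. adjacent I a p p' \<and> \<epsilon> \<alpha> = p \<longrightarrow>
        (\<exists>\<beta>. \<epsilon> \<beta> = p' \<and> (covers \<alpha> \<beta> \<or> covers \<beta> \<alpha>)))"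

definition full_heap :: "'i set \<Rightarrow> ('i \<Rightarrow> 'i \<Rightarrow> int) \<Rightarrow> ('e::order \<Rightarrow> 'i) \<Rightarrow> bool" where
  "full_heap I a \<epsilon> \<longleftrightarrow> fibred_heap I a \<epsilon> \<and>
     (\<forall>p \<alpha> \<beta>. \<alpha> < \<beta> \<and> \<epsilon> \<alpha> = p \<and> \<epsilon> \<beta> = p \<and> p \<notin> \<epsilon> ` {\<alpha><..<\<beta>} \<longrightarrow>
        (\<Sum>\<gamma>\<in>{\<alpha><..<\<beta>}. a p (\<epsilon> \<gamma>)) = -2)"

definition heap_ideal :: "'e::order set \<Rightarrow> bool" where
  "heap_ideal J \<longleftrightarrow> (\<forall>\<alpha>\<in>J. \<forall>\<beta>. \<beta> \<le> \<alpha> \<longrightarrow> \<beta> \<in> J)"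

definition proper_ideals :: "'i set \<Rightarrow> ('e::order \<Rightarrow> 'i) \<Rightarrow> 'e set set" where
  "proper_ideals I \<epsilon> = {J. heap_ideal J \<and> J \<noteq> {} \<and> J \<noteq> UNIV \<and>
     (\<forall>p\<in>I. J \<inter> \<epsilon> -` {p} \<noteq> {} \<and> J \<inter> \<epsilon> -` {p} \<noteq> \<epsilon> -` {p})}"

section \<open>Folding\<close>

definition diagram_involution ::
  "'j set \<Rightarrow> ('j \<Rightarrow> 'j \<Rightarrow> int) \<Rightarrow> ('j \<Rightarrow> 'j) \<Rightarrow> bool" where
  "diagram_involution J b \<mu> \<longleftrightarrow> bij_betw \<mu> J J \<and>
     (\<forall>p\<in>J. \<forall>q\<in>J. adjacent J b (\<mu> p) (\<mu> q) \<longleftrightarrow> adjacent J b p q) \<and>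
     (\<forall>p\<in>J. \<mu> (\<mu> p) = p) \<and> (\<exists>p\<in>J. \<mu> p \<noteq> p)"

definition orbit :: "('j \<Rightarrow> 'j) \<Rightarrow> 'j \<Rightarrow> 'j set" where
  "orbit \<mu> p = {p, \<mu> p}"

text \<open>The folded matrix, indexed by the orbits \<open>orbit \<mu> ` J\<close>.\<close>

definition folded_matrix ::
  "'j set \<Rightarrow> ('j \<Rightarrow> 'j \<Rightarrow> int) \<Rightarrow> ('j \<Rightarrow> 'j) \<Rightarrow> 'j set \<Rightarrow> 'j set \<Rightarrow> int" where
  "folded_matrix J b \<mu> P Q =
     (if P = Q then 2
      else if \<not> (\<exists>p\<in>P. \<exists>q\<in>Q. adjacent J b p q) then 0
      else if \<exists>p\<in>P. p \<noteq> \<mu> p \<and> (\<exists>q\<in>Q. adjacent J b q p \<and> adjacent J b q (\<mu> p)) then -2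
      else -1)"

definition foldable_heap ::
  "'j set \<Rightarrow> ('j \<Rightarrow> 'j \<Rightarrow> int) \<Rightarrow> ('j \<Rightarrow> 'j) \<Rightarrow> ('e::order \<Rightarrow> 'j) \<Rightarrow> bool" where
  "foldable_heap J b \<mu> \<epsilon> \<longleftrightarrow> full_heap J b \<epsilon> \<and>
     (\<forall>p\<in>J. \<forall>q\<in>J. \<mu> p = q \<or> adjacent J b (\<mu> p) q \<longrightarrow>
        (\<forall>\<alpha>\<in>\<epsilon> -` {p}. \<forall>\<beta>\<in>\<epsilon> -` {q}. \<alpha> \<le> \<beta> \<or> \<beta> \<le> \<alpha>))"

text \<open>In the non-simply-laced case \<open>\<phi>\<close> identifies the index set of \<open>b\<close> folded by \<open>\<mu>\<close>, i.e. the
  set of orbits, with \<open>I\<close>. Taking the vertices of the unfolded diagram to be natural numbers is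
  no restriction, since they are finite in number. As heaps are isomorphism classes, the unfolded
  heap may be taken to live on the poset of the given one.\<close>

definition simply_folded :: "'i set \<Rightarrow> ('i \<Rightarrow> 'i \<Rightarrow> int) \<Rightarrow> ('e::order \<Rightarrow> 'i) \<Rightarrow> bool" where
  "simply_folded I a \<epsilon> \<longleftrightarrow> untwisted_affine I a \<and> full_heap I a \<epsilon> \<and>
     (simply_laced I a \<or>
      \<not> simply_laced I a \<and>
      (\<exists>(J :: nat set) b \<mu> (\<epsilon>' :: 'e \<Rightarrow> nat) \<phi>.
         gcm J b \<and> simply_laced J b \<and> untwisted_affine J b \<and>
         diagram_involution J b \<mu> \<and> (\<forall>p\<in>J. \<not> adjacent J b p (\<mu> p)) \<and>
         foldable_heap J b \<mu> \<epsilon>' \<and>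
         bij_betw \<phi> (orbit \<mu> ` J) I \<and>
         (\<forall>P\<in>orbit \<mu> ` J. \<forall>Q\<in>orbit \<mu> ` J. a (\<phi> P) (\<phi> Q) = folded_matrix J b \<mu> P Q) \<and>
         (\<forall>\<alpha>. \<epsilon> \<alpha> = \<phi> (orbit \<mu> (\<epsilon>' \<alpha>)))))"

section \<open>Groups given by generators and relations; Weyl groups\<close>

text \<open>Group words over \<open>I\<close>: the letter \<open>(i, False)\<close> stands for the generator \<open>i\<close> and \<open>(i, True)\<close>
  for its inverse. \<open>pres_cong I R\<close> is the least congruence on words containing \<open>R\<close> and free
  cancellation.\<close>

type_synonym 'i word = "('i \<times> bool) list"

abbreviation words :: "'i set \<Rightarrow> 'i word set" where
  "words I \<equiv> lists (I \<times> UNIV)"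

inductive_set pres_cong :: "'i set \<Rightarrow> ('i word \<times> 'i word) set \<Rightarrow> ('i word \<times> 'i word) set"
  for I :: "'i set" and R :: "('i word \<times> 'i word) set" where
  refl: "x \<in> words I \<Longrightarrow> (x, x) \<in> pres_cong I R"
| sym: "(x, y) \<in> pres_cong I R \<Longrightarrow> (y, x) \<in> pres_cong I R"
| trans: "(x, y) \<in> pres_cong I R \<Longrightarrow> (y, z) \<in> pres_cong I R \<Longrightarrow> (x, z) \<in> pres_cong I R"
| cancel: "u \<in> words I \<Longrightarrow> v \<in> words I \<Longrightarrow> i \<in> I \<Longrightarrow>
    (u @ [(i, b), (i, \<not> b)] @ v, u @ v) \<in> pres_cong I R"
| rel: "u \<in> words I \<Longrightarrow> v \<in> words I \<Longrightarrow> (x, y) \<in> R \<Longrightarrow> x \<in> words I \<Longrightarrow> y \<in> words I \<Longrightarrow>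
    (u @ x @ v, u @ y @ v) \<in> pres_cong I R"

definition presented_group :: "'i set \<Rightarrow> ('i word \<times> 'i word) set \<Rightarrow> 'i word set monoid" where
  "presented_group I R =
     \<lparr>carrier = words I // pres_cong I R,
      mult = (\<lambda>X Y. \<Union>x\<in>X. \<Union>y\<in>Y. pres_cong I R `` {x @ y}),
      one = pres_cong I R `` {[]}\<rparr>"

definition gen_word :: "'i list \<Rightarrow> 'i word" where
  "gen_word is = map (\<lambda>i. (i, False)) is"

definition weyl_relations :: "'i set \<Rightarrow> ('i \<Rightarrow> 'i \<Rightarrow> int) \<Rightarrow> ('i word \<times> 'i word) set" where
  "weyl_relations I a =
     {(gen_word [i, i], []) |i. i \<in> I} \<union>
     {(gen_word [i, j], gen_word [j, i]) |i j. i \<in> I \<and> j \<in> I \<and> a i j = 0} \<union>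
     {(gen_word [i, j, i], gen_word [j, i, j]) |i j.
        i \<in> I \<and> j \<in> I \<and> a i j < 0 \<and> a i j * a j i = 1} \<union>
     {(gen_word [i, j, i, j], gen_word [j, i, j, i]) |i j.
        i \<in> I \<and> j \<in> I \<and> a i j < 0 \<and> a i j * a j i = 2}"

definition weyl_group :: "'i set \<Rightarrow> ('i \<Rightarrow> 'i \<Rightarrow> int) \<Rightarrow> 'i word set monoid" where
  "weyl_group I a = presented_group I (weyl_relations I a)"

definition weyl_gen :: "'i set \<Rightarrow> ('i \<Rightarrow> 'i \<Rightarrow> int) \<Rightarrow> 'i \<Rightarrow> 'i word set" where
  "weyl_gen I a i = pres_cong I (weyl_relations I a) `` {gen_word [i]}"

section \<open>Group algebras and left modules\<close>

definition scale :: "'k::field \<Rightarrow> ('b \<Rightarrow>\<^sub>0 'k) \<Rightarrow> ('b \<Rightarrow>\<^sub>0 'k)" where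
  "scale c f = Poly_Mapping.map ((*) c) f"

text \<open>The finitely supported functions on \<open>B\<close>, i.e. the \<open>'k\<close>-vector space with basis
  \<open>Poly_Mapping.single x 1\<close>, \<open>x \<in> B\<close>.\<close>

definition free_space :: "'b set \<Rightarrow> ('b \<Rightarrow>\<^sub>0 'k::field) set" where
  "free_space B = {f. Poly_Mapping.keys f \<subseteq> B}"

definition linear_extension ::
  "('b \<Rightarrow> ('c \<Rightarrow>\<^sub>0 'k)) \<Rightarrow> ('b \<Rightarrow>\<^sub>0 'k) \<Rightarrow> ('c \<Rightarrow>\<^sub>0 'k::field)" where
  "linear_extension g f = (\<Sum>x\<in>Poly_Mapping.keys f. scale (Poly_Mapping.lookup f x) (g x))"

definition group_algebra :: "'g monoid \<Rightarrow> ('g \<Rightarrow>\<^sub>0 'k::field) ring" where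
  "group_algebra G =
     \<lparr>carrier = free_space (carrier G),
      mult = (\<lambda>x y. \<Sum>g\<in>Poly_Mapping.keys x. \<Sum>h\<in>Poly_Mapping.keys y.
        Poly_Mapping.single (g \<otimes>\<^bsub>G\<^esub> h) (Poly_Mapping.lookup x g * Poly_Mapping.lookup y h)),
      one = Poly_Mapping.single \<one>\<^bsub>G\<^esub> 1,
      zero = 0,
      add = (+)\<rparr>"

text \<open>The library's module locale is restricted to commutative rings.\<close>

definition left_module ::
  "('r, 'm) ring_scheme \<Rightarrow> 'v::ab_group_add set \<Rightarrow> ('r \<Rightarrow> 'v \<Rightarrow> 'v) \<Rightarrow> bool" where
  "left_module R V act \<longleftrightarrow>
     0 \<in> V \<and> (\<forall>v\<in>V. \<forall>w\<in>V. v - w \<in> V) \<and>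
     (\<forall>x\<in>carrier R. \<forall>v\<in>V. act x v \<in> V) \<and>
     (\<forall>x\<in>carrier R. \<forall>v\<in>V. \<forall>w\<in>V. act x (v + w) = act x v + act x w) \<and>
     (\<forall>x\<in>carrier R. \<forall>y\<in>carrier R. \<forall>v\<in>V. act (x \<oplus>\<^bsub>R\<^esub> y) v = act x v + act y v) \<and>
     (\<forall>x\<in>carrier R. \<forall>y\<in>carrier R. \<forall>v\<in>V. act (x \<otimes>\<^bsub>R\<^esub> y) v = act x (act y v)) \<and>
     (\<forall>v\<in>V. act \<one>\<^bsub>R\<^esub> v = v)"

text \<open>A \<open>kG\<close>-module structure on the vector space \<open>V\<close>: the scalars of \<open>kG\<close> act through the given
  vector space structure. Action maps are extensional, so that they are determined by their values
  on \<open>kG \<times> V\<close>.\<close>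

definition group_algebra_module ::
  "'g monoid \<Rightarrow> ('b \<Rightarrow>\<^sub>0 'k::field) set \<Rightarrow>
   (('g \<Rightarrow>\<^sub>0 'k) \<Rightarrow> ('b \<Rightarrow>\<^sub>0 'k) \<Rightarrow> ('b \<Rightarrow>\<^sub>0 'k)) \<Rightarrow> bool" where
  "group_algebra_module G V act \<longleftrightarrow>
     act \<in> carrier (group_algebra G) \<rightarrow>\<^sub>E (V \<rightarrow>\<^sub>E V) \<and>
     left_module (group_algebra G) V act \<and>
     (\<forall>c. \<forall>v\<in>V. act (Poly_Mapping.single \<one>\<^bsub>G\<^esub> c) v = scale c v)"

definition generates_module ::
  "('r, 'm) ring_scheme \<Rightarrow> 'v set \<Rightarrow> ('r \<Rightarrow> 'v \<Rightarrow> 'v) \<Rightarrow> 'v \<Rightarrow> bool" where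
  "generates_module R V act v \<longleftrightarrow> v \<in> V \<and> (\<lambda>x. act x v) ` carrier R = V"

definition cyclic_module ::
  "('r, 'm) ring_scheme \<Rightarrow> 'v set \<Rightarrow> ('r \<Rightarrow> 'v \<Rightarrow> 'v) \<Rightarrow> bool" where
  "cyclic_module R V act \<longleftrightarrow> (\<exists>v. generates_module R V act v)"

section \<open>The operators on the span of the proper ideals\<close>

abbreviation (input) ideal_vec :: "'e set \<Rightarrow> ('e set \<Rightarrow>\<^sub>0 'k::field)" where
  "ideal_vec J \<equiv> Poly_Mapping.single J 1"

definition heap_space :: "'i set \<Rightarrow> ('e::order \<Rightarrow> 'i) \<Rightarrow> ('e set \<Rightarrow>\<^sub>0 'k::field) set" where
  "heap_space I \<epsilon> = free_space (proper_ideals I \<epsilon>)"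

text \<open>The operators on basis vectors. The elements \<open>\<alpha>\<close> below are unique because every label class
  of a heap is a chain.\<close>

definition X_basis :: "('e::order \<Rightarrow> 'i) \<Rightarrow> 'i \<Rightarrow> 'e set \<Rightarrow> ('e set \<Rightarrow>\<^sub>0 'k::field)" where
  "X_basis \<epsilon> p J =
     (if \<exists>\<alpha>. \<alpha> \<notin> J \<and> \<epsilon> \<alpha> = p \<and> heap_ideal (J \<union> {\<alpha>})
      then ideal_vec (J \<union> {THE \<alpha>. \<alpha> \<notin> J \<and> \<epsilon> \<alpha> = p \<and> heap_ideal (J \<union> {\<alpha>})})
      else 0)"

definition Y_basis :: "('e::order \<Rightarrow> 'i) \<Rightarrow> 'i \<Rightarrow> 'e set \<Rightarrow> ('e set \<Rightarrow>\<^sub>0 'k::field)" where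
  "Y_basis \<epsilon> p J =
     (if \<exists>\<alpha>. \<alpha> \<in> J \<and> \<epsilon> \<alpha> = p \<and> heap_ideal (J - {\<alpha>})
      then ideal_vec (J - {THE \<alpha>. \<alpha> \<in> J \<and> \<epsilon> \<alpha> = p \<and> heap_ideal (J - {\<alpha>})})
      else 0)"

definition S_basis :: "('e::order \<Rightarrow> 'i) \<Rightarrow> 'i \<Rightarrow> 'e set \<Rightarrow> ('e set \<Rightarrow>\<^sub>0 'k::field)" where
  "S_basis \<epsilon> p J =
     (if Y_basis \<epsilon> p J \<noteq> (0 :: 'e set \<Rightarrow>\<^sub>0 'k) then Y_basis \<epsilon> p J
      else if X_basis \<epsilon> p J \<noteq> (0 :: 'e set \<Rightarrow>\<^sub>0 'k) then X_basis \<epsilon> p J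
      else ideal_vec J)"

definition S_op ::
  "('e::order \<Rightarrow> 'i) \<Rightarrow> 'i \<Rightarrow> ('e set \<Rightarrow>\<^sub>0 'k) \<Rightarrow> ('e set \<Rightarrow>\<^sub>0 'k::field)" where
  "S_op \<epsilon> p = linear_extension (S_basis \<epsilon> p)"

definition heap_module ::
  "'i set \<Rightarrow> ('i \<Rightarrow> 'i \<Rightarrow> int) \<Rightarrow> ('e::order \<Rightarrow> 'i) \<Rightarrow>
   (('i word set \<Rightarrow>\<^sub>0 'k::field) \<Rightarrow> ('e set \<Rightarrow>\<^sub>0 'k) \<Rightarrow> ('e set \<Rightarrow>\<^sub>0 'k)) \<Rightarrow> bool" where
  "heap_module I a \<epsilon> act \<longleftrightarrow>
     group_algebra_module (weyl_group I a) (heap_space I \<epsilon>) act \<and>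
     (\<forall>i\<in>I. \<forall>v\<in>heap_space I \<epsilon>. act (Poly_Mapping.single (weyl_gen I a i) 1) v = - S_op \<epsilon> i v)"

end

theory Submission
  imports Defs
begin

text \<open>A proper ideal \<open>J\<close> cuts every label class, a chain, between a largest element inside
  \<open>J\<close> and a smallest element outside \<open>J\<close>. Fullness says that the neighbours of \<open>i\<close> lying between
  these two elements of label \<open>i\<close> have total Cartan weight \<open>-2\<close>. How much of it falls inside \<open>J\<close>
  gives an integer \<open>weight i J\<close> in \<open>{-1, 0, 1}\<close>, which says whether the largest element inside
  can be removed (\<open>-1\<close>), the smallest element outside can be added (\<open>1\<close>), or neither is possible
  (\<open>0\<close>). Thus \<open>S\<^sub>i\<close> permutes the proper ideals by an involution \<open>toggle i\<close>, and
  \<open>weight_toggle\<close> shows that the weights of \<open>J\<close> change under \<open>toggle j\<close> by the simple reflection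
  given by the \<open>j\<close>-th column of the Cartan matrix.

  The bound on the weights makes every pair of noncommuting toggles transparent: in the cases
  \<open>A\<^sub>2\<close> and \<open>B\<^sub>2\<close> their orbits are fixed points or paths on three and four ideals, along which the two
  toggles swap neighbours alternately. The braid relations can be read off
  (\<open>toggle_braid3\<close>, \<open>toggle_braid4\<close>). Toggles for nonadjacent labels commute because neither
  affects the frontier or the weight seen by the other. As both sides of every Weyl group relation
  have lengths of the same parity, the group acts by toggles twisted with the sign character,
  which is the module structure of the first claim; it is unique since an action of a group algebra is
  determined by the generators of the group.

  For the second claim it suffices to find, for each ideal \<open>J\<close>, an element of \<open>W\<^sub>i\<^sub>j\<close> acting on \<open>v\<^sub>J\<close>
  as \<open>-1\<close>: multiplying the sum over \<open>W\<^sub>i\<^sub>j\<close> by it from the right permutes the summands, so the sum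
  sends \<open>v\<^sub>J\<close> to its own negative (\<open>sum_over_subgroup_annihilates\<close>), hence to \<open>0\<close> because
  \<open>2\<close> is invertible. Such an element is \<open>s\<^sub>i\<close>, \<open>s\<^sub>j\<close>, \<open>s\<^sub>i s\<^sub>j s\<^sub>i\<close> or \<open>s\<^sub>j s\<^sub>i s\<^sub>j\<close>
  (\<open>fixing_reflection\<close>); it can only be missing if \<open>a\<^sub>i\<^sub>j = a\<^sub>j\<^sub>i = -2\<close> and \<open>J\<close> grows forever under
  alternating toggles in one of the two orders, which makes \<open>W\<^sub>i\<^sub>j\<close> infinite.

  For the third claim, any two proper ideals differ by finitely many elements on either side, and
  those can be removed or added one at a time. Hence the toggles act transitively, and the orbit of
  \<open>v\<^sub>J\<close> contains every basis vector up to sign.\<close>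

section \<open>Free vector spaces\<close>

lemma lookup_scale [simp]: "Poly_Mapping.lookup (scale c f) x = c * Poly_Mapping.lookup f x"
  by (simp add: scale_def Poly_Mapping.map.rep_eq when_def)

lemma scale_one [simp]: "scale 1 f = f"
  and scale_zero_left [simp]: "scale 0 f = 0"
  and scale_zero_right [simp]: "scale c 0 = 0"
  and scale_scale [simp]: "scale c (scale d f) = scale (c * d) f"
  and scale_add_left: "scale (c + d) f = scale c f + scale d f"
  and scale_add_right: "scale c (f + g) = scale c f + scale c g"
  and scale_single [simp]: "scale c (Poly_Mapping.single x d) = Poly_Mapping.single x (c * d)"
  by (rule poly_mapping_eqI, simp add: lookup_add lookup_single when_def algebra_simps)+

lemma scale_sum: "scale c (\<Sum>i\<in>A. f i) = (\<Sum>i\<in>A. scale c (f i))"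
  by (induction A rule: infinite_finite_induct) (simp_all add: scale_add_right)

lemma free_space_zero [simp]: "0 \<in> free_space B"
  and free_space_single [simp]: "x \<in> B \<Longrightarrow> Poly_Mapping.single x c \<in> free_space B"
  and free_space_scale: "f \<in> free_space B \<Longrightarrow> scale c f \<in> free_space B"
  by (auto simp: free_space_def in_keys_iff lookup_single when_def split: if_splits)

lemma free_space_add: "f \<in> free_space B \<Longrightarrow> g \<in> free_space B \<Longrightarrow> f + g \<in> free_space B"
  and free_space_diff: "f \<in> free_space B \<Longrightarrow> g \<in> free_space B \<Longrightarrow> f - g \<in> free_space B"
  by (simp_all add: free_space_def subset_iff in_keys_iff lookup_add lookup_minus)
    (metis add_0, metis diff_zero)

lemma free_space_sum: "(\<And>i. i \<in> A \<Longrightarrow> f i \<in> free_space B) \<Longrightarrow> (\<Sum>i\<in>A. f i) \<in> free_space B"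
  by (induction A rule: infinite_finite_induct) (auto intro: free_space_add)

lemma sum_of_singles: "(\<Sum>x\<in>Poly_Mapping.keys f. Poly_Mapping.single x (Poly_Mapping.lookup f x)) = f"
  by (rule poly_mapping_eqI)
    (simp add: lookup_sum lookup_single when_def in_keys_iff)

lemma free_space_induct [consumes 1, case_names zero add single]:
  assumes "f \<in> free_space B"
    and "P 0"
    and "\<And>f g. f \<in> free_space B \<Longrightarrow> g \<in> free_space B \<Longrightarrow> P f \<Longrightarrow> P g \<Longrightarrow> P (f + g)"
    and "\<And>x c. x \<in> B \<Longrightarrow> P (Poly_Mapping.single x c)"
  shows "P f"
proof -
  have "finite A \<Longrightarrow> A \<subseteq> B \<Longrightarrow>
      (\<Sum>x\<in>A. Poly_Mapping.single x (h x)) \<in> free_space B \<and>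
      P (\<Sum>x\<in>A. Poly_Mapping.single x (h x))" for A and h
    by (induction A rule: finite_induct) (auto intro!: assms free_space_add)
  from this[of "Poly_Mapping.keys f" "Poly_Mapping.lookup f"] show ?thesis
    using assms(1) by (simp add: sum_of_singles free_space_def)
qed

lemma linear_extension_superset:
  assumes "finite A" "Poly_Mapping.keys f \<subseteq> A"
  shows "linear_extension g f = (\<Sum>x\<in>A. scale (Poly_Mapping.lookup f x) (g x))"
  unfolding linear_extension_def
  by (rule sum.mono_neutral_left) (use assms in \<open>auto simp: in_keys_iff\<close>)

lemma linear_extension_zero [simp]: "linear_extension g 0 = 0"
  by (simp add: linear_extension_def)

lemma linear_extension_single [simp]:
  "linear_extension g (Poly_Mapping.single x c) = scale c (g x)"
  by (simp add: linear_extension_def)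

lemma linear_extension_add:
  "linear_extension g (f + h) = linear_extension g f + linear_extension g h"
proof -
  let ?A = "Poly_Mapping.keys f \<union> Poly_Mapping.keys h"
  have "Poly_Mapping.keys (f + h) \<subseteq> ?A" by (rule Poly_Mapping.keys_add)
  then show ?thesis
    by (simp add: linear_extension_superset[where A = ?A] lookup_add scale_add_left sum.distrib)
qed

lemma linear_extension_scale: "linear_extension g (scale c f) = scale c (linear_extension g f)"
proof -
  have "Poly_Mapping.keys (scale c f) \<subseteq> Poly_Mapping.keys f" by (auto simp: in_keys_iff)
  then show ?thesis
    by (simp add: linear_extension_superset[where A = "Poly_Mapping.keys f"] scale_sum)
qed

lemma linear_extension_sum:
  "linear_extension g (\<Sum>i\<in>A. f i) = (\<Sum>i\<in>A. linear_extension g (f i))"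
  by (induction A rule: infinite_finite_induct) (simp_all add: linear_extension_add)

lemma linear_extension_in_free_space:
  assumes "f \<in> free_space A" "\<And>x. x \<in> A \<Longrightarrow> g x \<in> free_space B"
  shows "linear_extension g f \<in> free_space B"
  using assms by (auto simp: linear_extension_def free_space_def[of A]
      intro!: free_space_sum free_space_scale)

lemma no_two_torsion:
  fixes v :: "'b \<Rightarrow>\<^sub>0 'k::field"
  assumes "CHAR('k) \<noteq> 2" "v = - v"
  shows "v = 0"
proof (rule poly_mapping_eqI)
  fix x
  have "(2 :: 'k) \<noteq> 0"
  proof
    assume "(2 :: 'k) = 0"
    then have "CHAR('k) dvd 2" by (metis of_nat_eq_0_iff_char_dvd of_nat_numeral)
    then have "CHAR('k) \<le> 2" "CHAR('k) \<noteq> 0" by (auto dest: dvd_imp_le intro!: Nat.gr0I)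
    with assms(1) CHAR_not_1[where ?'a = 'k] show False by linarith
  qed
  moreover have "Poly_Mapping.lookup v x = - Poly_Mapping.lookup v x"
    using assms(2) by (metis lookup_uminus)
  then have "2 * Poly_Mapping.lookup v x = 0"
    by (metis add.right_inverse mult_2)
  ultimately show "Poly_Mapping.lookup v x = Poly_Mapping.lookup 0 x" by simp
qed

section \<open>Modules over group algebras\<close>

lemma group_algebra_simps:
  "carrier (group_algebra G) = free_space (carrier G)"
  "\<one>\<^bsub>group_algebra G\<^esub> = Poly_Mapping.single \<one>\<^bsub>G\<^esub> 1"
  "x \<oplus>\<^bsub>group_algebra G\<^esub> y = x + y"
  by (simp_all add: group_algebra_def)

lemma group_algebra_mult:
  "x \<otimes>\<^bsub>group_algebra G\<^esub> y = (\<Sum>g\<in>Poly_Mapping.keys x. \<Sum>h\<in>Poly_Mapping.keys y.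
     Poly_Mapping.single (g \<otimes>\<^bsub>G\<^esub> h) (Poly_Mapping.lookup x g * Poly_Mapping.lookup y h))"
  by (simp add: group_algebra_def)

lemma group_algebra_mult_single:
  "Poly_Mapping.single g c \<otimes>\<^bsub>group_algebra G\<^esub> Poly_Mapping.single h d =
     (Poly_Mapping.single (g \<otimes>\<^bsub>G\<^esub> h) (c * d) :: _ \<Rightarrow>\<^sub>0 'k::field)"
  by (simp add: group_algebra_mult)

text \<open>A representation of \<open>G\<close> extends linearly to \<open>kG\<close>. The restrictions make the extension
  extensional, as a module structure has to be.\<close>

lemma representation_module:
  fixes \<rho> :: "'g \<Rightarrow> ('b \<Rightarrow>\<^sub>0 'k::field) \<Rightarrow> ('b \<Rightarrow>\<^sub>0 'k)"
  assumes G: "monoid G"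
    and closed: "\<And>g v. g \<in> carrier G \<Longrightarrow> v \<in> free_space B \<Longrightarrow> \<rho> g v \<in> free_space B"
    and add: "\<And>g v w. g \<in> carrier G \<Longrightarrow> \<rho> g (v + w) = \<rho> g v + \<rho> g w"
    and scale: "\<And>g c v. g \<in> carrier G \<Longrightarrow> \<rho> g (scale c v) = scale c (\<rho> g v)"
    and mult: "\<And>g h v. g \<in> carrier G \<Longrightarrow> h \<in> carrier G \<Longrightarrow> v \<in> free_space B \<Longrightarrow>
      \<rho> (g \<otimes>\<^bsub>G\<^esub> h) v = \<rho> g (\<rho> h v)"
    and one: "\<And>v. v \<in> free_space B \<Longrightarrow> \<rho> \<one>\<^bsub>G\<^esub> v = v"
  shows "group_algebra_module G (free_space B)
    (restrict (\<lambda>x. restrict (\<lambda>v. linear_extension (\<lambda>g. \<rho> g v) x) (free_space B))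
       (carrier (group_algebra G)))"
proof -
  interpret monoid G by fact
  let ?V = "free_space B" and ?R = "group_algebra G :: ('g \<Rightarrow>\<^sub>0 'k) ring"
  let ?act = "\<lambda>x v. linear_extension (\<lambda>g. \<rho> g v) x"
  have R: "x \<in> carrier ?R \<longleftrightarrow> Poly_Mapping.keys x \<subseteq> carrier G" for x
    by (simp add: group_algebra_simps free_space_def)
  have act_closed: "?act x v \<in> ?V" if "x \<in> carrier ?R" "v \<in> ?V" for x v
    using that by (auto simp: group_algebra_simps intro: linear_extension_in_free_space closed)
  have \<rho>_zero: "\<rho> g 0 = 0" if "g \<in> carrier G" for g
    using scale[OF that, of 0 0] by simp
  have \<rho>_sum: "\<rho> g (\<Sum>i\<in>A. f i) = (\<Sum>i\<in>A. \<rho> g (f i))" if "g \<in> carrier G" for g A and f :: "'g \<Rightarrow> _"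
    by (induction A rule: infinite_finite_induct) (use that in \<open>simp_all add: \<rho>_zero add\<close>)
  have act_add: "?act x (v + w) = ?act x v + ?act x w" if "x \<in> carrier ?R" for x v w
    using that unfolding R linear_extension_def
    by (subst sum.distrib[symmetric], intro sum.cong) (auto simp: add scale_add_right)
  have mult_closed: "x \<otimes>\<^bsub>?R\<^esub> y \<in> carrier ?R" if "x \<in> carrier ?R" "y \<in> carrier ?R" for x y
    unfolding group_algebra_mult group_algebra_simps
    by (intro free_space_sum free_space_single) (use that in \<open>auto simp: R\<close>)
  have add_closed: "x + y \<in> carrier ?R" if "x \<in> carrier ?R" "y \<in> carrier ?R" for x y
    using that by (simp add: group_algebra_simps free_space_add)
  have act_mult: "?act (x \<otimes>\<^bsub>?R\<^esub> y) v = ?act x (?act y v)"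
    if x: "x \<in> carrier ?R" and y: "y \<in> carrier ?R" and v: "v \<in> ?V" for x y v
  proof -
    have "?act (x \<otimes>\<^bsub>?R\<^esub> y) v = (\<Sum>g\<in>Poly_Mapping.keys x. \<Sum>h\<in>Poly_Mapping.keys y.
       scale (Poly_Mapping.lookup x g * Poly_Mapping.lookup y h) (\<rho> (g \<otimes>\<^bsub>G\<^esub> h) v))"
      by (simp add: group_algebra_mult linear_extension_sum)
    also have "\<dots> = (\<Sum>g\<in>Poly_Mapping.keys x. \<Sum>h\<in>Poly_Mapping.keys y.
       scale (Poly_Mapping.lookup x g * Poly_Mapping.lookup y h) (\<rho> g (\<rho> h v)))"
      using x y v by (intro sum.cong refl) (auto simp: R subset_iff mult)
    also have "\<dots> = ?act x (?act y v)"
      unfolding linear_extension_def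
      using x by (intro sum.cong refl) (auto simp: R subset_iff \<rho>_sum scale scale_sum)
    finally show ?thesis .
  qed
  have one_closed: "Poly_Mapping.single \<one>\<^bsub>G\<^esub> c \<in> carrier ?R" for c
    by (simp add: group_algebra_simps)
  show ?thesis
    unfolding group_algebra_module_def left_module_def
  proof (intro conjI ballI allI)
    show "restrict (\<lambda>x. restrict (?act x) ?V) (carrier ?R) \<in> carrier ?R \<rightarrow>\<^sub>E (?V \<rightarrow>\<^sub>E ?V)"
      using act_closed by auto
  qed (use act_closed act_add act_mult add_closed mult_closed one_closed one in
      \<open>simp_all add: free_space_diff free_space_add linear_extension_add group_algebra_simps(2,3)\<close>)
qed

lemma group_algebra_module_scale:
  fixes act :: "('g \<Rightarrow>\<^sub>0 'k::field) \<Rightarrow> ('b \<Rightarrow>\<^sub>0 'k) \<Rightarrow> ('b \<Rightarrow>\<^sub>0 'k)"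
  assumes "monoid G" and act: "group_algebra_module G V act" and "g \<in> carrier G" and v: "v \<in> V"
  shows "act (Poly_Mapping.single g c) v = scale c (act (Poly_Mapping.single g 1) v)"
proof -
  interpret monoid G by fact
  let ?R = "group_algebra G :: ('g \<Rightarrow>\<^sub>0 'k) ring"
  have "Poly_Mapping.single g c =
      (Poly_Mapping.single \<one>\<^bsub>G\<^esub> c \<otimes>\<^bsub>?R\<^esub> Poly_Mapping.single g 1 :: 'g \<Rightarrow>\<^sub>0 'k)"
    using \<open>g \<in> carrier G\<close> by (simp add: group_algebra_mult_single)
  moreover have "Poly_Mapping.single \<one>\<^bsub>G\<^esub> c \<in> carrier ?R" "Poly_Mapping.single g 1 \<in> carrier ?R"
    using \<open>g \<in> carrier G\<close> by (simp_all add: group_algebra_simps)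
  ultimately show ?thesis
    using act v unfolding group_algebra_module_def left_module_def by metis
qed

lemma group_algebra_module_zero:
  assumes act: "group_algebra_module G V act" and v: "v \<in> V"
  shows "act 0 v = 0"
proof -
  have "0 \<in> carrier (group_algebra G)" by (simp add: group_algebra_simps)
  then have "act (0 + 0) v = act 0 v + act 0 v"
    using act v unfolding group_algebra_module_def left_module_def group_algebra_simps by blast
  then show ?thesis by simp
qed

lemma group_algebra_module_add:
  assumes "group_algebra_module G V act" "v \<in> V" "x \<in> free_space (carrier G)" "y \<in> free_space (carrier G)"
  shows "act (x + y) v = act x v + act y v"
  using assms unfolding group_algebra_module_def left_module_def group_algebra_simps by blast

lemma group_algebra_module_sum:
  assumes act: "group_algebra_module G V act" "v \<in> V"
    and "\<And>i. i \<in> A \<Longrightarrow> x i \<in> free_space (carrier G)"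
  shows "act (\<Sum>i\<in>A. x i) v = (\<Sum>i\<in>A. act (x i) v)"
  using assms(3)
  by (induction A rule: infinite_finite_induct)
    (simp_all add: group_algebra_module_zero[OF act] group_algebra_module_add[OF act] free_space_sum)

text \<open>An action of \<open>kG\<close> can be recovered from the elements of \<open>G\<close>, which is what makes module
  structures with prescribed generators unique.\<close>

lemma group_algebra_module_linear_extension:
  assumes G: "monoid G" and act: "group_algebra_module G V act" "v \<in> V"
    and x: "x \<in> free_space (carrier G)"
  shows "act x v = linear_extension (\<lambda>g. act (Poly_Mapping.single g 1) v) x"
  using x
proof (induction rule: free_space_induct)
  case zero
  then show ?case by (simp add: group_algebra_module_zero[OF act])
next
  case (add x y)
  then show ?case by (simp add: group_algebra_module_add[OF act] linear_extension_add)
next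
  case (single g c)
  show ?case
    unfolding linear_extension_single
    by (rule group_algebra_module_scale[OF G act(1) single act(2)])
qed

text \<open>Right multiplication by \<open>r\<close> permutes \<open>H\<close> but changes the sign of every term \<open>h v\<close>; so the
  sum of these terms equals its own negative.\<close>

lemma sum_over_subgroup_annihilates:
  fixes G (structure) and act :: "('a \<Rightarrow>\<^sub>0 'k::field) \<Rightarrow> ('b \<Rightarrow>\<^sub>0 'k) \<Rightarrow> ('b \<Rightarrow>\<^sub>0 'k)"
  assumes "group G" and char: "CHAR('k) \<noteq> 2" and act: "group_algebra_module G V act"
    and H: "subgroup H G" and r: "r \<in> H" and v: "v \<in> V"
    and neg: "act (Poly_Mapping.single r 1) v = - v"
  shows "act (\<Sum>h\<in>H. Poly_Mapping.single h 1) v = 0"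
proof -
  interpret group G by fact
  let ?R = "group_algebra G :: ('a \<Rightarrow>\<^sub>0 'k) ring" and ?s = "\<lambda>h. Poly_Mapping.single h 1 :: 'a \<Rightarrow>\<^sub>0 'k"
  have HG: "h \<in> carrier G" if "h \<in> H" for h using subgroup.mem_carrier[OF H that] .
  have sR: "?s h \<in> carrier ?R" if "h \<in> H" for h using HG[OF that] by (simp add: group_algebra_simps)
  have mod: "left_module ?R V act" using act by (simp add: group_algebra_module_def)
  have z: "act x 0 = 0" if "x \<in> carrier ?R" for x
  proof -
    have "act x (0 + 0) = act x 0 + act x 0" using mod that unfolding left_module_def by blast
    then show ?thesis by simp
  qed
  have nv: "- v \<in> V"
  proof -
    have "0 - v \<in> V" using mod v unfolding left_module_def by blast
    then show ?thesis by simp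
  qed
  have minus: "act (?s h) (- v) = - act (?s h) v" if "h \<in> H" for h
  proof -
    have "act (?s h) (v + - v) = act (?s h) v + act (?s h) (- v)"
      using mod v nv sR[OF that] unfolding left_module_def by blast
    then show ?thesis using z[OF sR[OF that]] by (simp add: eq_neg_iff_add_eq_0 add.commute)
  qed
  have step: "act (?s (h \<otimes> r)) v = - act (?s h) v" if "h \<in> H" for h
  proof -
    have "act (?s h \<otimes>\<^bsub>?R\<^esub> ?s r) v = act (?s h) (act (?s r) v)"
      using mod v sR[OF that] sR[OF r] unfolding left_module_def by blast
    then show ?thesis using minus[OF that] neg by (simp add: group_algebra_mult_single)
  qed
  have bij: "bij_betw (\<lambda>h. h \<otimes> r) H H"
  proof (rule bij_betw_byWitness[where f' = "\<lambda>h. h \<otimes> inv r"])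
    show "\<forall>h\<in>H. h \<otimes> r \<otimes> inv r = h" "\<forall>h\<in>H. h \<otimes> inv r \<otimes> r = h"
      using HG HG[OF r] by (auto simp: m_assoc)
    show "(\<lambda>h. h \<otimes> r) ` H \<subseteq> H" "(\<lambda>h. h \<otimes> inv r) ` H \<subseteq> H"
      using r H by (auto intro: subgroup.m_closed subgroup.m_inv_closed)
  qed
  have total: "act (\<Sum>h\<in>H. ?s h) v = (\<Sum>h\<in>H. act (?s h) v)"
    by (rule group_algebra_module_sum[OF act v]) (use HG in auto)
  also have "\<dots> = (\<Sum>h\<in>H. act (?s (h \<otimes> r)) v)"
    by (rule sum.reindex_bij_betw[OF bij, symmetric])
  also have "\<dots> = - act (\<Sum>h\<in>H. ?s h) v" by (simp add: step sum_negf total)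
  finally show ?thesis by (rule no_two_torsion[OF char])
qed

section \<open>Proper ideals of a full heap\<close>

text \<open>The order of a heap is generated by comparisons between related labels. Such a
  generating chain may contain trivial steps, so its first and last proper steps have to be found by
  induction. They locate an obstruction to removing or adding an element of an ideal at an element
  of related label.\<close>

lemma tranclp_le_first_step:
  fixes \<alpha> \<beta> :: "'e::order"
  assumes "(\<lambda>x y. x \<le> y \<and> R x y)\<^sup>+\<^sup>+ \<alpha> \<beta>" "\<alpha> \<noteq> \<beta>"
  shows "\<exists>\<gamma>. \<alpha> < \<gamma> \<and> \<gamma> \<le> \<beta> \<and> R \<alpha> \<gamma>"
  using assms
proof (induction rule: converse_tranclp_induct)
  case (base y)
  then show ?case by (auto simp: order.strict_iff_order)
next
  case (step y z)
  from step.hyps(2) have "z \<le> \<beta>"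
    by (induction rule: converse_tranclp_induct) auto
  with step show ?case by (cases "y = z") (auto simp: order.strict_iff_order)
qed

lemma tranclp_le_last_step:
  fixes \<alpha> \<beta> :: "'e::order"
  assumes "(\<lambda>x y. x \<le> y \<and> R x y)\<^sup>+\<^sup>+ \<alpha> \<beta>" "\<alpha> \<noteq> \<beta>"
  shows "\<exists>\<gamma>. \<alpha> \<le> \<gamma> \<and> \<gamma> < \<beta> \<and> R \<gamma> \<beta>"
  using assms
proof (induction rule: tranclp_induct)
  case (base y)
  then show ?case by (auto simp: order.strict_iff_order)
next
  case (step y z)
  from step.hyps(1) have "\<alpha> \<le> y"
    by (induction rule: tranclp_induct) auto
  with step show ?case by (cases "y = z") (auto simp: order.strict_iff_order)
qed

locale full_heap_over =
  fixes I :: "'i set" and a :: "'i \<Rightarrow> 'i \<Rightarrow> int" and \<epsilon> :: "'e::order \<Rightarrow> 'i"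
  assumes gcm: "gcm I a" and full: "full_heap I a \<epsilon>"
begin

abbreviation ideals :: "'e set set" where
  "ideals \<equiv> proper_ideals I \<epsilon>"

lemma fibred: "fibred_heap I a \<epsilon>" and heap: "labelled_heap I a \<epsilon>"
  using full by (auto simp: full_heap_def fibred_heap_def)

lemma finite_I: "finite I"
  and diagonal: "i \<in> I \<Longrightarrow> a i i = 2"
  and off_diagonal: "i \<in> I \<Longrightarrow> j \<in> I \<Longrightarrow> i \<noteq> j \<Longrightarrow> a i j \<in> {0, -1, -2}"
  and zero_sym: "i \<in> I \<Longrightarrow> j \<in> I \<Longrightarrow> i \<noteq> j \<Longrightarrow> a i j = 0 \<longleftrightarrow> a j i = 0"
  using gcm by (auto simp: gcm_def)

lemma label_in: "\<epsilon> \<alpha> \<in> I"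
  using heap by (auto simp: labelled_heap_def)

lemma finite_interval: "finite {\<alpha>..\<beta> :: 'e}"
  using heap by (auto simp: labelled_heap_def)

lemma finite_open_interval: "finite {\<alpha><..<\<beta> :: 'e}"
  by (rule finite_subset[OF _ finite_interval[of \<alpha> \<beta>]]) auto

text \<open>For labels of heap elements this means equality or adjacency. Phrased by matrix entries it says
  directly whether an element contributes to the sums in the fullness condition.\<close>

definition related :: "'e \<Rightarrow> 'e \<Rightarrow> bool" where
  "related \<alpha> \<beta> \<longleftrightarrow> \<epsilon> \<alpha> = \<epsilon> \<beta> \<or> a (\<epsilon> \<alpha>) (\<epsilon> \<beta>) \<noteq> 0"

lemma related_iff: "related \<alpha> \<beta> \<longleftrightarrow> \<epsilon> \<alpha> = \<epsilon> \<beta> \<or> adjacent I a (\<epsilon> \<alpha>) (\<epsilon> \<beta>)"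
  by (auto simp: related_def adjacent_def label_in)

lemma related_sym: "related \<alpha> \<beta> \<Longrightarrow> related \<beta> \<alpha>"
  using zero_sym[OF label_in label_in] by (auto simp: related_def)

lemma related_comparable: "related \<alpha> \<beta> \<Longrightarrow> \<alpha> \<le> \<beta> \<or> \<beta> \<le> \<alpha>"
  using heap by (auto simp: labelled_heap_def related_iff)

lemma related_closure:
  assumes "\<alpha> \<le> \<beta>" shows "(\<lambda>x y. x \<le> y \<and> related x y)\<^sup>+\<^sup>+ \<alpha> \<beta>"
proof -
  have "(\<le>) = (\<lambda>x y :: 'e. x \<le> y \<and> related x y)\<^sup>+\<^sup>+"
    using heap by (simp add: labelled_heap_def related_iff)
  then show ?thesis using assms by metis
qed

lemma related_above: "\<alpha> < \<beta> \<Longrightarrow> \<exists>\<gamma>. \<alpha> < \<gamma> \<and> \<gamma> \<le> \<beta> \<and> related \<alpha> \<gamma>"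
  using tranclp_le_first_step[OF related_closure] by (auto simp: order.strict_iff_order)

lemma related_below: "\<alpha> < \<beta> \<Longrightarrow> \<exists>\<gamma>. \<alpha> \<le> \<gamma> \<and> \<gamma> < \<beta> \<and> related \<gamma> \<beta>"
  using tranclp_le_last_step[OF related_closure] by (auto simp: order.strict_iff_order)

text \<open>The vertex set is inhabited by the label of any element, so the conditions on the label classes
  already exclude the empty set and the whole heap.\<close>

lemma ideals_iff:
  "J \<in> ideals \<longleftrightarrow> heap_ideal J \<and> (\<forall>p\<in>I. (\<exists>\<alpha>\<in>J. \<epsilon> \<alpha> = p) \<and> (\<exists>\<alpha>. \<alpha> \<notin> J \<and> \<epsilon> \<alpha> = p))"
  using label_in[of undefined] unfolding proper_ideals_def by fast

lemma ideal_down: "J \<in> ideals \<Longrightarrow> \<alpha> \<in> J \<Longrightarrow> \<beta> \<le> \<alpha> \<Longrightarrow> \<beta> \<in> J"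
  by (auto simp: ideals_iff heap_ideal_def)

subsection \<open>The frontier of an ideal\<close>

definition top_in :: "'i \<Rightarrow> 'e set \<Rightarrow> 'e" where
  "top_in i J = (GREATEST \<alpha>. \<alpha> \<in> J \<and> \<epsilon> \<alpha> = i)"

definition bot_out :: "'i \<Rightarrow> 'e set \<Rightarrow> 'e" where
  "bot_out i J = (LEAST \<alpha>. \<alpha> \<notin> J \<and> \<epsilon> \<alpha> = i)"

lemma same_label_comparable: "\<epsilon> \<alpha> = \<epsilon> \<beta> \<Longrightarrow> \<alpha> \<le> \<beta> \<or> \<beta> \<le> \<alpha>"
  using related_comparable by (simp add: related_def)

lemma top_in_exists:
  assumes J: "J \<in> ideals" and i: "i \<in> I"
  shows "\<exists>m. m \<in> J \<and> \<epsilon> m = i \<and> (\<forall>\<gamma>. \<gamma> \<in> J \<and> \<epsilon> \<gamma> = i \<longrightarrow> \<gamma> \<le> m)"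
proof -
  obtain x y where x: "x \<in> J" "\<epsilon> x = i" and y: "y \<notin> J" "\<epsilon> y = i"
    using J i by (auto simp: ideals_iff)
  let ?C = "{z. z \<in> J \<and> \<epsilon> z = i \<and> x \<le> z}"
  have "?C \<subseteq> {x..y}"
    using y same_label_comparable ideal_down[OF J] by fastforce
  then have "finite ?C" using finite_interval finite_subset by blast
  moreover have "?C \<noteq> {}" using x by auto
  ultimately obtain m where m: "m \<in> ?C" and max: "\<And>z. z \<in> ?C \<Longrightarrow> m \<le> z \<Longrightarrow> m = z"
    by (metis (no_types, lifting) finite_has_maximal)
  have "\<gamma> \<le> m" if "\<gamma> \<in> J" "\<epsilon> \<gamma> = i" for \<gamma>
    using that m max same_label_comparable[of \<gamma> m] by (auto dest: order.trans)
  then show ?thesis using m by auto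
qed

lemma bot_out_exists:
  assumes J: "J \<in> ideals" and i: "i \<in> I"
  shows "\<exists>m. m \<notin> J \<and> \<epsilon> m = i \<and> (\<forall>\<gamma>. \<gamma> \<notin> J \<and> \<epsilon> \<gamma> = i \<longrightarrow> m \<le> \<gamma>)"
proof -
  obtain x y where x: "x \<in> J" "\<epsilon> x = i" and y: "y \<notin> J" "\<epsilon> y = i"
    using J i by (auto simp: ideals_iff)
  let ?C = "{z. z \<notin> J \<and> \<epsilon> z = i \<and> z \<le> y}"
  have "?C \<subseteq> {x..y}"
    using x same_label_comparable ideal_down[OF J] by fastforce
  then have "finite ?C" using finite_interval finite_subset by blast
  moreover have "?C \<noteq> {}" using y by auto
  ultimately obtain m where m: "m \<in> ?C" and min: "\<And>z. z \<in> ?C \<Longrightarrow> z \<le> m \<Longrightarrow> m = z"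
    by (metis (no_types, lifting) finite_has_minimal)
  have "m \<le> \<gamma>" if "\<gamma> \<notin> J" "\<epsilon> \<gamma> = i" for \<gamma>
    using that m min same_label_comparable[of \<gamma> m] by (auto dest: order.trans)
  then show ?thesis using m by auto
qed

lemma top_in_eqI:
  "m \<in> J \<Longrightarrow> \<epsilon> m = i \<Longrightarrow> (\<And>\<gamma>. \<gamma> \<in> J \<Longrightarrow> \<epsilon> \<gamma> = i \<Longrightarrow> \<gamma> \<le> m) \<Longrightarrow> top_in i J = m"
  unfolding top_in_def by (rule Greatest_equality) auto

lemma bot_out_eqI:
  "m \<notin> J \<Longrightarrow> \<epsilon> m = i \<Longrightarrow> (\<And>\<gamma>. \<gamma> \<notin> J \<Longrightarrow> \<epsilon> \<gamma> = i \<Longrightarrow> m \<le> \<gamma>) \<Longrightarrow> bot_out i J = m"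
  unfolding bot_out_def by (rule Least_equality) auto

lemma top_in:
  assumes "J \<in> ideals" "i \<in> I"
  shows "top_in i J \<in> J" "\<epsilon> (top_in i J) = i"
    and "\<And>\<gamma>. \<gamma> \<in> J \<Longrightarrow> \<epsilon> \<gamma> = i \<Longrightarrow> \<gamma> \<le> top_in i J"
  using top_in_exists[OF assms] top_in_eqI by metis+

lemma bot_out:
  assumes "J \<in> ideals" "i \<in> I"
  shows "bot_out i J \<notin> J" "\<epsilon> (bot_out i J) = i"
    and "\<And>\<gamma>. \<gamma> \<notin> J \<Longrightarrow> \<epsilon> \<gamma> = i \<Longrightarrow> bot_out i J \<le> \<gamma>"
  using bot_out_exists[OF assms] bot_out_eqI by metis+

definition gap :: "'i \<Rightarrow> 'e set \<Rightarrow> 'e set" where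
  "gap i J = {top_in i J<..<bot_out i J}"

lemma finite_gap: "finite (gap i J)"
  by (simp add: gap_def finite_open_interval)

lemma gap_label:
  assumes "J \<in> ideals" "i \<in> I" "\<gamma> \<in> gap i J" shows "\<epsilon> \<gamma> \<noteq> i"
  using assms top_in(3)[OF assms(1,2)] bot_out(3)[OF assms(1,2)]
  by (cases "\<gamma> \<in> J") (force simp: gap_def)+

lemma top_less_bot:
  assumes "J \<in> ideals" "i \<in> I" shows "top_in i J < bot_out i J"
  using same_label_comparable[of "top_in i J" "bot_out i J"] top_in[OF assms] bot_out[OF assms]
    ideal_down[OF assms(1)] by (metis order.strict_iff_order)

lemma gap_sum:
  assumes "J \<in> ideals" "i \<in> I"
  shows "(\<Sum>\<gamma>\<in>gap i J. a i (\<epsilon> \<gamma>)) = -2"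
proof -
  have "i \<notin> \<epsilon> ` gap i J" using gap_label[OF assms] by auto
  then show ?thesis
    using full top_less_bot[OF assms] top_in(2)[OF assms] bot_out(2)[OF assms]
    unfolding full_heap_def gap_def by blast
qed

lemma gap_nonpos:
  assumes "J \<in> ideals" "i \<in> I" "\<gamma> \<in> gap i J" shows "a i (\<epsilon> \<gamma>) \<le> 0"
  using off_diagonal[OF assms(2) label_in, of \<gamma>] gap_label[OF assms] by force

text \<open>Up to sign this is the value of the \<open>i\<close>-th simple coroot on the weight of \<open>v\<^sub>J\<close>. The
  constant makes it symmetric: the gap carries total \<open>-2\<close>, so the part inside \<open>J\<close> and the part
  outside each contribute \<open>0\<close>, \<open>-1\<close> or \<open>-2\<close>.\<close>

definition weight :: "'i \<Rightarrow> 'e set \<Rightarrow> int" where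
  "weight i J = - 1 - (\<Sum>\<gamma>\<in>gap i J \<inter> J. a i (\<epsilon> \<gamma>))"

lemma weight_alt:
  assumes "J \<in> ideals" "i \<in> I"
  shows "weight i J = 1 + (\<Sum>\<gamma>\<in>gap i J - J. a i (\<epsilon> \<gamma>))"
  using gap_sum[OF assms] sum.Int_Diff[OF finite_gap, of "\<lambda>\<gamma>. a i (\<epsilon> \<gamma>)" i J J]
  by (simp add: weight_def)

lemma weight_range:
  assumes "J \<in> ideals" "i \<in> I"
  shows "weight i J \<in> {-1, 0, 1}"
proof -
  have "(\<Sum>\<gamma>\<in>gap i J \<inter> J. a i (\<epsilon> \<gamma>)) \<le> 0" "(\<Sum>\<gamma>\<in>gap i J - J. a i (\<epsilon> \<gamma>)) \<le> 0"
    by (rule sum_nonpos; use gap_nonpos[OF assms] in auto)+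
  then show ?thesis using weight_alt[OF assms] by (auto simp: weight_def)
qed

text \<open>Anything in \<open>J\<close> above the largest element of label \<open>i\<close> forces an element of \<open>J\<close> with adjacent
  label above it. Being comparable with the next element of label \<open>i\<close>, which is not in \<open>J\<close>, it
  lies in the gap and contributes a nonzero entry. The argument for adding an element is dual.\<close>

lemma weight_neg_iff:
  assumes J: "J \<in> ideals" and i: "i \<in> I"
  shows "weight i J = -1 \<longleftrightarrow> heap_ideal (J - {top_in i J})"
proof -
  have "weight i J = -1 \<longleftrightarrow> (\<Sum>\<gamma>\<in>gap i J \<inter> J. - a i (\<epsilon> \<gamma>)) = 0"
    by (simp add: weight_def sum_negf)
  also have "\<dots> \<longleftrightarrow> (\<forall>\<gamma>\<in>gap i J \<inter> J. - a i (\<epsilon> \<gamma>) = 0)"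
    by (rule sum_nonneg_eq_0_iff) (use finite_gap gap_nonpos[OF assms] in auto)
  also have "\<dots> \<longleftrightarrow> (\<forall>\<gamma>\<in>J. \<not> top_in i J < \<gamma>)"
  proof (safe)
    fix \<gamma> assume 0: "\<forall>\<gamma>\<in>gap i J \<inter> J. - a i (\<epsilon> \<gamma>) = 0" and "\<gamma> \<in> J" "top_in i J < \<gamma>"
    then obtain \<delta> where \<delta>: "top_in i J < \<delta>" "\<delta> \<le> \<gamma>" "related (top_in i J) \<delta>"
      using related_above by blast
    have "\<delta> \<in> J" using \<delta> \<open>\<gamma> \<in> J\<close> ideal_down[OF J] by blast
    moreover have "\<epsilon> \<delta> \<noteq> i" using top_in(3)[OF assms \<open>\<delta> \<in> J\<close>] \<delta>(1) by auto
    ultimately have ai: "a i (\<epsilon> \<delta>) \<noteq> 0" using \<delta>(3) top_in(2)[OF assms] by (auto simp: related_def)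
    then have "related (bot_out i J) \<delta>" using bot_out(2)[OF assms] by (auto simp: related_def)
    then have "\<delta> < bot_out i J"
      using related_comparable[of "bot_out i J" \<delta>] ideal_down[OF J \<open>\<delta> \<in> J\<close>] bot_out(1)[OF assms] \<open>\<delta> \<in> J\<close>
      by (metis order.strict_iff_order)
    then have "\<delta> \<in> gap i J \<inter> J" using \<delta> \<open>\<delta> \<in> J\<close> by (auto simp: gap_def)
    with 0 ai show False by auto
  qed (auto simp: gap_def)
  also have "\<dots> \<longleftrightarrow> heap_ideal (J - {top_in i J})"
    using ideal_down[OF J] top_in(1)[OF assms]
    by (auto simp: heap_ideal_def order.strict_iff_order)
  finally show ?thesis .
qed

lemma weight_pos_iff:
  assumes J: "J \<in> ideals" and i: "i \<in> I"
  shows "weight i J = 1 \<longleftrightarrow> heap_ideal (insert (bot_out i J) J)"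
proof -
  have "weight i J = 1 \<longleftrightarrow> (\<Sum>\<gamma>\<in>gap i J - J. - a i (\<epsilon> \<gamma>)) = 0"
    by (simp add: weight_alt[OF assms] sum_negf)
  also have "\<dots> \<longleftrightarrow> (\<forall>\<gamma>\<in>gap i J - J. - a i (\<epsilon> \<gamma>) = 0)"
    by (rule sum_nonneg_eq_0_iff) (use finite_gap gap_nonpos[OF assms] in auto)
  also have "\<dots> \<longleftrightarrow> (\<forall>\<gamma>. \<gamma> \<notin> J \<longrightarrow> \<not> \<gamma> < bot_out i J)"
  proof (safe)
    fix \<gamma> assume 0: "\<forall>\<gamma>\<in>gap i J - J. - a i (\<epsilon> \<gamma>) = 0" and "\<gamma> \<notin> J" "\<gamma> < bot_out i J"
    then obtain \<delta> where \<delta>: "\<delta> < bot_out i J" "\<gamma> \<le> \<delta>" "related \<delta> (bot_out i J)"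
      using related_below by blast
    have "\<delta> \<notin> J" using \<delta> \<open>\<gamma> \<notin> J\<close> ideal_down[OF J] by blast
    moreover have "\<epsilon> \<delta> \<noteq> i" using bot_out(3)[OF assms \<open>\<delta> \<notin> J\<close>] \<delta>(1) by auto
    ultimately have ai: "a i (\<epsilon> \<delta>) \<noteq> 0"
      using related_sym[OF \<delta>(3)] bot_out(2)[OF assms] by (auto simp: related_def)
    then have "related (top_in i J) \<delta>" using top_in(2)[OF assms] by (auto simp: related_def)
    then have "top_in i J < \<delta>"
      using related_comparable[of "top_in i J" \<delta>] ideal_down[OF J] top_in(1)[OF assms] \<open>\<delta> \<notin> J\<close>
      by (metis order.strict_iff_order)
    then have "\<delta> \<in> gap i J - J" using \<delta> \<open>\<delta> \<notin> J\<close> by (auto simp: gap_def)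
    with 0 ai show False by auto
  qed (auto simp: gap_def)
  also have "\<dots> \<longleftrightarrow> heap_ideal (insert (bot_out i J) J)"
    using ideal_down[OF J] bot_out(1)[OF assms]
    by (auto simp: heap_ideal_def order.strict_iff_order)
  finally show ?thesis .
qed

subsection \<open>Toggling\<close>

definition toggle :: "'i \<Rightarrow> 'e set \<Rightarrow> 'e set" where
  "toggle i J = (if weight i J = -1 then J - {top_in i J}
     else if weight i J = 1 then insert (bot_out i J) J else J)"

lemma removable_unique:
  assumes J: "J \<in> ideals" and "\<alpha> \<in> J" "\<epsilon> \<alpha> = i" "heap_ideal (J - {\<alpha>})"
  shows "\<alpha> = top_in i J"
proof -
  have i: "i \<in> I" using assms label_in by auto
  show ?thesis
  proof (rule ccontr)
    assume "\<alpha> \<noteq> top_in i J"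
    then have "top_in i J \<in> J - {\<alpha>}" using top_in(1)[OF J i] by auto
    moreover have "\<alpha> \<le> top_in i J" using top_in(3)[OF J i] assms by auto
    ultimately show False using assms(4) unfolding heap_ideal_def by blast
  qed
qed

lemma addable_unique:
  assumes J: "J \<in> ideals" and "\<alpha> \<notin> J" "\<epsilon> \<alpha> = i" "heap_ideal (insert \<alpha> J)"
  shows "\<alpha> = bot_out i J"
proof -
  have i: "i \<in> I" using assms label_in by auto
  show ?thesis
  proof (rule ccontr)
    assume "\<alpha> \<noteq> bot_out i J"
    then have "bot_out i J \<notin> insert \<alpha> J" using bot_out(1)[OF J i] by auto
    moreover have "bot_out i J \<le> \<alpha>" using bot_out(3)[OF J i] assms by auto
    ultimately show False using assms(4) unfolding heap_ideal_def by blast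
  qed
qed

text \<open>Removing and adding an element of label \<open>i\<close> exclude each other, being told apart by the sign of
  the weight, so the order in which \<open>Y\<close> and \<open>X\<close> are tried is immaterial.\<close>

lemma S_basis_eq:
  assumes J: "J \<in> ideals" and i: "i \<in> I"
  shows "S_basis \<epsilon> i J = (Poly_Mapping.single (toggle i J) 1 :: 'e set \<Rightarrow>\<^sub>0 'k::field)"
proof -
  have nz: "Poly_Mapping.single K (1::'k) \<noteq> 0" for K :: "'e set"
    by (metis lookup_single_eq lookup_zero zero_neq_one)
  have rem: "\<alpha> \<in> J \<and> \<epsilon> \<alpha> = i \<and> heap_ideal (J - {\<alpha>}) \<longleftrightarrow> weight i J = -1 \<and> \<alpha> = top_in i J" for \<alpha>
    using removable_unique[OF J] weight_neg_iff[OF assms] top_in[OF assms] by metis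
  have add: "\<alpha> \<notin> J \<and> \<epsilon> \<alpha> = i \<and> heap_ideal (J \<union> {\<alpha>}) \<longleftrightarrow> weight i J = 1 \<and> \<alpha> = bot_out i J" for \<alpha>
    using addable_unique[OF J] weight_pos_iff[OF assms] bot_out[OF assms]
    by (metis Un_insert_right sup_bot.right_neutral)
  show ?thesis
    unfolding S_basis_def Y_basis_def X_basis_def rem add toggle_def
    by (auto simp: nz)
qed

text \<open>An ideal stays proper when it loses or gains one element, because the label classes are
  unbounded in both directions.\<close>

lemma remove_in_ideals:
  assumes J: "J \<in> ideals" and "heap_ideal (J - {\<alpha>})"
  shows "J - {\<alpha>} \<in> ideals"
proof (cases "\<alpha> \<in> J")
  case True
  let ?i = "\<epsilon> \<alpha>"
  have "\<not> bdd_below (\<epsilon> -` {?i})"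
    using fibred label_in by (auto simp: fibred_heap_def)
  then obtain \<beta> where \<beta>: "\<epsilon> \<beta> = ?i" "\<not> \<alpha> \<le> \<beta>" unfolding bdd_below_def by blast
  then have "\<beta> \<in> J - {\<alpha>}"
    using same_label_comparable[of \<alpha> \<beta>] ideal_down[OF J True] by auto
  then have "\<exists>\<gamma>\<in>J - {\<alpha>}. \<epsilon> \<gamma> = p" if "p \<in> I" for p
    using J \<beta>(1) that by (cases "p = ?i") (auto simp: ideals_iff)
  then show ?thesis using assms by (auto simp: ideals_iff)
qed (use J in simp)

lemma add_in_ideals:
  assumes J: "J \<in> ideals" and K: "heap_ideal (insert \<alpha> J)"
  shows "insert \<alpha> J \<in> ideals"
proof -
  let ?i = "\<epsilon> \<alpha>"
  have "\<not> bdd_above (\<epsilon> -` {?i})"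
    using fibred label_in by (auto simp: fibred_heap_def)
  then obtain \<beta> where \<beta>: "\<epsilon> \<beta> = ?i" "\<not> \<beta> \<le> \<alpha>" unfolding bdd_above_def by blast
  have out: "\<exists>\<gamma>. \<gamma> \<notin> insert \<alpha> J \<and> \<epsilon> \<gamma> = p" if "p \<in> I" for p
  proof (cases "\<alpha> \<in> J \<or> p \<noteq> ?i")
    case True
    obtain \<gamma> where "\<gamma> \<notin> J" "\<epsilon> \<gamma> = p" using J \<open>p \<in> I\<close> unfolding ideals_iff by blast
    then show ?thesis using True by auto
  next
    case False
    have "\<beta> \<notin> insert \<alpha> J"
      using \<beta> same_label_comparable[of \<alpha> \<beta>] ideal_down[OF J, of \<beta> \<alpha>] False by auto
    then show ?thesis using \<beta>(1) False by blast
  qed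
  show ?thesis using J K out by (auto simp: ideals_iff)
qed

lemma toggle_in_ideals:
  assumes "J \<in> ideals" "i \<in> I" shows "toggle i J \<in> ideals"
  using assms remove_in_ideals add_in_ideals weight_neg_iff[OF assms] weight_pos_iff[OF assms]
  by (auto simp: toggle_def)

lemma frontier_insert_other:
  assumes J: "J \<in> ideals" and i: "i \<in> I" and "\<epsilon> \<beta> \<noteq> i"
  shows "top_in i (insert \<beta> J) = top_in i J" "bot_out i (insert \<beta> J) = bot_out i J"
  using assms by (auto simp: top_in bot_out intro!: top_in_eqI bot_out_eqI)

text \<open>Each added element \<open>\<beta>\<close> with adjacent label falls into the current gap of \<open>i\<close>, since it is
  comparable with both ends; so it moves its matrix entry to the part inside the ideal. If \<open>\<beta>\<close> has
  label \<open>i\<close>, the gap itself moves up, from all of its weight inside to none of it.\<close>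

lemma weight_insert:
  assumes J: "J \<in> ideals" and K: "insert \<beta> J \<in> ideals" and "\<beta> \<notin> J" and i: "i \<in> I"
  shows "weight i (insert \<beta> J) = weight i J - a i (\<epsilon> \<beta>)"
proof (cases "\<epsilon> \<beta> = i")
  case True
  have hK: "heap_ideal (insert \<beta> J)" and hJ: "heap_ideal J" using J K by (auto simp: ideals_iff)
  have b: "\<beta> = bot_out i J" using addable_unique[OF J \<open>\<beta> \<notin> J\<close> True hK] .
  have "\<beta> = top_in i (insert \<beta> J)"
    by (rule removable_unique[OF K]) (use True \<open>\<beta> \<notin> J\<close> hJ in auto)
  then have "weight i (insert \<beta> J) = -1"
    using weight_neg_iff[OF K i] hJ \<open>\<beta> \<notin> J\<close> by (metis Diff_insert_absorb)
  moreover have "weight i J = 1" using weight_pos_iff[OF J i] hK b by metis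
  ultimately show ?thesis using True diagonal[OF i] by simp
next
  case False
  have gap: "gap i (insert \<beta> J) = gap i J"
    using frontier_insert_other[OF J i False] by (simp add: gap_def)
  show ?thesis
  proof (cases "a i (\<epsilon> \<beta>) = 0")
    case True
    have "(\<Sum>\<gamma>\<in>gap i J \<inter> insert \<beta> J. a i (\<epsilon> \<gamma>)) = (\<Sum>\<gamma>\<in>gap i J \<inter> J. a i (\<epsilon> \<gamma>))"
      by (rule sum.mono_neutral_right) (use True finite_gap in auto)
    then show ?thesis using True gap by (simp add: weight_def)
  next
    case nz: False
    have "related (top_in i J) \<beta>" "related (bot_out i J) \<beta>"
      using nz top_in(2)[OF J i] bot_out(2)[OF J i] by (auto simp: related_def)
    then have cmp: "top_in i J \<le> \<beta> \<or> \<beta> \<le> top_in i J" "bot_out i J \<le> \<beta> \<or> \<beta> \<le> bot_out i J"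
      using related_comparable by auto
    have ne: "top_in i J \<noteq> \<beta>" "bot_out i J \<noteq> \<beta>"
      using False top_in(2)[OF J i] bot_out(2)[OF J i] by auto
    have "\<not> \<beta> \<le> top_in i J" using ideal_down[OF J top_in(1)[OF J i]] \<open>\<beta> \<notin> J\<close> by auto
    moreover have "\<not> bot_out i J \<le> \<beta>"
      using ideal_down[OF K, of \<beta> "bot_out i J"] bot_out(1)[OF J i] ne by auto
    ultimately have "\<beta> \<in> gap i J" using cmp ne by (auto simp: gap_def order.strict_iff_order)
    then have "gap i J \<inter> insert \<beta> J = insert \<beta> (gap i J \<inter> J)" by auto
    then show ?thesis using gap finite_gap \<open>\<beta> \<notin> J\<close> by (simp add: weight_def)
  qed
qed

lemma toggle_up:
  assumes "J \<in> ideals" "j \<in> I" "weight j J = 1"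
  shows "toggle j J = insert (bot_out j J) J" "insert (bot_out j J) J \<in> ideals"
  using assms toggle_in_ideals[of J j] by (simp_all add: toggle_def)

lemma toggle_down:
  assumes "J \<in> ideals" "j \<in> I" "weight j J = -1"
  shows "toggle j J = J - {top_in j J}" "J - {top_in j J} \<in> ideals"
    "insert (top_in j J) (J - {top_in j J}) = J"
  using assms toggle_in_ideals[of J j] top_in(1)[of J j] by (auto simp add: toggle_def)

lemma toggle_fixed: "weight j J = 0 \<Longrightarrow> toggle j J = J"
  by (simp add: toggle_def)

text \<open>The simple reflection \<open>s\<^sub>j\<close> on the vector of weights. As the weights never
  leave \<open>{-1, 0, 1}\<close>, it restricts which weights can occur together at two adjacent labels.\<close>

lemma weight_toggle:
  assumes J: "J \<in> ideals" and i: "i \<in> I" and j: "j \<in> I"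
  shows "weight i (toggle j J) = weight i J - a i j * weight j J"
proof -
  consider "weight j J = 1" | "weight j J = -1" | "weight j J = 0" using weight_range[OF J j] by auto
  then show ?thesis
  proof cases
    case 1
    then show ?thesis
      using toggle_up[OF J j] weight_insert[OF J, of "bot_out j J" i] bot_out[OF J j] i by simp
  next
    case 2
    note d = toggle_down[OF J j 2]
    have "weight i J = weight i (J - {top_in j J}) - a i j"
      using weight_insert[OF d(2), of "top_in j J" i] d(3) J i top_in(2)[OF J j] by simp
    then show ?thesis using d(1) 2 by simp
  next
    case 3
    then show ?thesis by (simp add: toggle_fixed)
  qed
qed

lemma toggle_toggle:
  assumes J: "J \<in> ideals" and i: "i \<in> I"
  shows "toggle i (toggle i J) = J"
proof -
  note T = toggle_in_ideals[OF assms]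
  have w: "weight i (toggle i J) = - weight i J"
    using weight_toggle[OF J i i] diagonal[OF i] by simp
  consider "weight i J = 1" | "weight i J = -1" | "weight i J = 0" using weight_range[OF J i] by auto
  then show ?thesis
  proof cases
    case 1
    note u = toggle_up[OF J i 1]
    have "bot_out i J = top_in i (toggle i J)"
      by (rule removable_unique[OF T])
        (use u bot_out[OF J i] J in \<open>auto simp: ideals_iff\<close>)
    moreover have "weight i (toggle i J) = -1" using w 1 by simp
    then have "toggle i (toggle i J) = toggle i J - {top_in i (toggle i J)}"
      by (rule toggle_down(1)[OF T i])
    ultimately show ?thesis using u bot_out(1)[OF J i] by auto
  next
    case 2
    note d = toggle_down[OF J i 2]
    have "top_in i J = bot_out i (toggle i J)"
      by (rule addable_unique[OF T])
        (use d top_in[OF J i] J in \<open>auto simp: ideals_iff insert_absorb\<close>)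
    moreover have "weight i (toggle i J) = 1" using w 2 by simp
    then have "toggle i (toggle i J) = insert (bot_out i (toggle i J)) (toggle i J)"
      by (rule toggle_up(1)[OF T i])
    ultimately show ?thesis using d by auto
  next
    case 3
    then show ?thesis by (simp add: toggle_fixed)
  qed
qed

lemma frontier_toggle_other:
  assumes J: "J \<in> ideals" and i: "i \<in> I" and j: "j \<in> I" and "i \<noteq> j"
  shows "top_in i (toggle j J) = top_in i J \<and> bot_out i (toggle j J) = bot_out i J"
proof -
  consider "weight j J = 1" | "weight j J = -1" | "weight j J = 0" using weight_range[OF J j] by auto
  then show ?thesis
  proof cases
    case 1
    then show ?thesis
      using toggle_up[OF J j] frontier_insert_other[OF J i] bot_out[OF J j] \<open>i \<noteq> j\<close> by simp
  next
    case 2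
    note d = toggle_down[OF J j 2]
    show ?thesis
      using d frontier_insert_other[OF d(2) i, of "top_in j J"] top_in[OF J j] \<open>i \<noteq> j\<close> by simp
  next
    case 3
    then show ?thesis by (simp add: toggle_fixed)
  qed
qed

text \<open>Whether and where \<open>J\<close> can be changed at label \<open>i\<close> depends on the frontier and the weight at
  \<open>i\<close>; a toggle at a label that is not adjacent leaves both unchanged.\<close>

lemma toggle_commute:
  assumes J: "J \<in> ideals" and i: "i \<in> I" and j: "j \<in> I" and a0: "a i j = 0"
  shows "toggle i (toggle j J) = toggle j (toggle i J)"
proof -
  have ne: "i \<noteq> j" using a0 diagonal[OF i] by auto
  have w: "weight i (toggle j J) = weight i J" "weight j (toggle i J) = weight j J"
    using weight_toggle[OF J i j] weight_toggle[OF J j i] a0 zero_sym[OF i j ne] by simp_all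
  have f: "top_in i (toggle j J) = top_in i J" "bot_out i (toggle j J) = bot_out i J"
    "top_in j (toggle i J) = top_in j J" "bot_out j (toggle i J) = bot_out j J"
    using frontier_toggle_other[OF J i j ne] frontier_toggle_other[OF J j i ne[symmetric]] by auto
  have d: "top_in i J \<noteq> bot_out j J" "top_in j J \<noteq> bot_out i J"
    using ne top_in(2)[OF J] bot_out(2)[OF J] i j by metis+
  show ?thesis
    unfolding toggle_def[of i "toggle j J"] toggle_def[of j "toggle i J"] w f
    using d by (auto simp: toggle_def)
qed

text \<open>The weights at \<open>(i, j)\<close> are \<open>(0, 0)\<close>, where both toggles fix the ideal, or they run through
  one of the paths \<open>(1, 0), (-1, 1), (0, -1)\<close> and \<open>(0, 1), (1, -1), (-1, 0)\<close>: any other pair would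
  be reflected out of the admissible range. A toggle moves along the path or, if its weight is \<open>0\<close>,
  does nothing; so each side of the braid relation reverses the path.\<close>

lemma toggle_braid3:
  assumes J: "J \<in> ideals" and i: "i \<in> I" and j: "j \<in> I" and "a i j = -1" "a j i = -1"
  shows "toggle i (toggle j (toggle i J)) = toggle j (toggle i (toggle j J))"
proof -
  have w: "weight i (toggle j K) = weight i K + weight j K"
      "weight j (toggle i K) = weight j K + weight i K"
      "weight i (toggle i K) = - weight i K" "weight j (toggle j K) = - weight j K"
    if "K \<in> ideals" for K
    using weight_toggle[OF that] i j assms(4,5) diagonal by simp_all
  note T = toggle_in_ideals[OF _ i] toggle_in_ideals[OF _ j]
  note r = weight_range[OF J i] weight_range[OF J j]
    weight_range[OF T(1)[OF J] j] weight_range[OF T(2)[OF J] i]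
  show ?thesis
    using r J by (auto simp: w T toggle_fixed toggle_toggle i j)
qed

text \<open>Here the only nontrivial path is \<open>(1, 0), (-1, 1), (1, -1), (-1, 0)\<close>. The products with four
  factors both reverse it.\<close>

lemma toggle_braid4:
  assumes J: "J \<in> ideals" and i: "i \<in> I" and j: "j \<in> I" and "a i j = -2" "a j i = -1"
  shows "toggle i (toggle j (toggle i (toggle j J))) = toggle j (toggle i (toggle j (toggle i J)))"
proof -
  have w: "weight i (toggle j K) = weight i K + 2 * weight j K"
      "weight j (toggle i K) = weight j K + weight i K"
      "weight i (toggle i K) = - weight i K" "weight j (toggle j K) = - weight j K"
    if "K \<in> ideals" for K
    using weight_toggle[OF that] i j assms(4,5) diagonal by simp_all
  note T = toggle_in_ideals[OF _ i] toggle_in_ideals[OF _ j]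
  note r = weight_range[OF J i] weight_range[OF J j]
    weight_range[OF T(1)[OF J] j] weight_range[OF T(2)[OF J] i]
  show ?thesis
    using r J by (auto simp: w T toggle_fixed toggle_toggle i j)
qed

end

section \<open>Groups given by generators and relations\<close>

abbreviation word_class :: "'i set \<Rightarrow> ('i word \<times> 'i word) set \<Rightarrow> 'i word \<Rightarrow> 'i word set" where
  "word_class I R u \<equiv> pres_cong I R `` {u}"

lemma pres_cong_words: "(x, y) \<in> pres_cong I R \<Longrightarrow> x \<in> words I \<and> y \<in> words I"
  by (induction rule: pres_cong.induct) auto

lemma equiv_pres_cong: "equiv (words I) (pres_cong I R)"
proof (rule equivI)
  show "pres_cong I R \<subseteq> words I \<times> words I"
    by (clarify, drule pres_cong_words) simp
  show "refl_on (words I) (pres_cong I R)" by (rule refl_onI) (rule pres_cong.refl)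
  show "sym (pres_cong I R)" by (rule symI) (rule pres_cong.sym)
  show "trans (pres_cong I R)" by (rule transI) (rule pres_cong.trans)
qed

lemma word_class_eq_iff:
  assumes "u \<in> words I" "v \<in> words I"
  shows "word_class I R u = word_class I R v \<longleftrightarrow> (u, v) \<in> pres_cong I R"
  using eq_equiv_class_iff[OF equiv_pres_cong assms] .

lemma pres_cong_context:
  assumes "(x, y) \<in> pres_cong I R" "u \<in> words I" "v \<in> words I"
  shows "(u @ x @ v, u @ y @ v) \<in> pres_cong I R"
  using assms
proof (induction rule: pres_cong.induct)
  case (refl x)
  then show ?case by (intro pres_cong.refl) auto
next
  case (cancel u' v' i b)
  then show ?case using pres_cong.cancel[of "u @ u'" I "v' @ v" i b R] by simp
next
  case (rel u' v' x y)
  then show ?case using pres_cong.rel[of "u @ u'" I "v' @ v" x y R] by simp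
next
  case (sym x y)
  show ?case by (rule pres_cong.sym) (use sym in simp)
next
  case (trans x y z)
  show ?case by (rule pres_cong.trans) (use trans in simp_all)
qed

lemma pres_cong_append:
  assumes "(x, x') \<in> pres_cong I R" "(y, y') \<in> pres_cong I R"
  shows "(x @ y, x' @ y') \<in> pres_cong I R"
  using pres_cong_context[OF assms(1), of "[]" y] pres_cong_context[OF assms(2), of x' "[]"]
    pres_cong_words[OF assms(1)] pres_cong_words[OF assms(2)]
  by (auto intro: pres_cong.trans)

lemma word_class_carrier: "u \<in> words I \<Longrightarrow> word_class I R u \<in> carrier (presented_group I R)"
  by (simp add: presented_group_def quotientI)

lemma word_class_cases:
  assumes "g \<in> carrier (presented_group I R)"
  obtains u where "u \<in> words I" "g = word_class I R u"
  using assms by (auto simp: presented_group_def quotient_def)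

text \<open>The product of classes in the presented group is a union over all representatives; the
  congruence property collapses it.\<close>

lemma word_class_mult:
  assumes x: "x \<in> words I" and y: "y \<in> words I"
  shows "word_class I R x \<otimes>\<^bsub>presented_group I R\<^esub> word_class I R y = word_class I R (x @ y)"
proof -
  have const: "word_class I R (x' @ y') = word_class I R (x @ y)"
    if "x' \<in> word_class I R x" "y' \<in> word_class I R y" for x' y'
  proof -
    have "(x @ y, x' @ y') \<in> pres_cong I R" using that by (auto intro: pres_cong_append)
    then show ?thesis using equiv_class_eq[OF equiv_pres_cong] by metis
  qed
  have "x \<in> word_class I R x" "y \<in> word_class I R y"
    using x y by (simp_all add: pres_cong.refl)
  then have "(\<Union>y'\<in>word_class I R y. word_class I R (x' @ y')) = word_class I R (x @ y)"
    if "x' \<in> word_class I R x" for x'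
    using that const by (intro UN_constant_eq[of y]) blast+
  then have "(\<Union>x'\<in>word_class I R x. \<Union>y'\<in>word_class I R y. word_class I R (x' @ y')) =
      word_class I R (x @ y)"
    using \<open>x \<in> word_class I R x\<close> by (intro UN_constant_eq[of x]) blast+
  then show ?thesis by (simp add: presented_group_def)
qed

lemma word_class_one: "\<one>\<^bsub>presented_group I R\<^esub> = word_class I R []"
  by (simp add: presented_group_def)

lemma inverse_word_in_words:
  "u \<in> words I \<Longrightarrow> map (\<lambda>(i, b). (i, \<not> b)) (rev u) \<in> words I"
  by (induction u) auto

lemma inverse_word_cancel:
  assumes "u \<in> words I"
  shows "(map (\<lambda>(i, b). (i, \<not> b)) (rev u) @ u, []) \<in> pres_cong I R"
  using assms
proof (induction u rule: list.induct)
  case Nil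
  then show ?case by (auto intro: pres_cong.refl)
next
  case (Cons l u)
  obtain i b where l: "l = (i, b)" by fastforce
  let ?u' = "map (\<lambda>(i, b). (i, \<not> b)) (rev u)"
  have "u \<in> words I" using Cons.prems by simp
  then have "?u' \<in> words I" by (rule inverse_word_in_words)
  then have "(?u' @ [(i, \<not> b), (i, \<not> \<not> b)] @ u, ?u' @ u) \<in> pres_cong I R"
    using Cons.prems l by (intro pres_cong.cancel) auto
  then show ?case using Cons l by (auto intro: pres_cong.trans)
qed

lemma group_presented_group: "group (presented_group I R)"
proof (rule groupI)
  let ?G = "presented_group I R"
  show "\<one>\<^bsub>?G\<^esub> \<in> carrier ?G" by (simp add: word_class_one word_class_carrier)
  fix x assume "x \<in> carrier ?G"
  then obtain u where u: "u \<in> words I" and x: "x = word_class I R u" by (rule word_class_cases)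
  show "\<one>\<^bsub>?G\<^esub> \<otimes>\<^bsub>?G\<^esub> x = x"
    unfolding x word_class_one using word_class_mult[of "[]" I u R] u by simp
  let ?u' = "map (\<lambda>(i, b). (i, \<not> b)) (rev u)"
  have u': "?u' \<in> words I" using u by (rule inverse_word_in_words)
  have "word_class I R ?u' \<otimes>\<^bsub>?G\<^esub> x = \<one>\<^bsub>?G\<^esub>"
    unfolding x word_class_one word_class_mult[OF u' u]
    using inverse_word_cancel[OF u] by (simp add: word_class_eq_iff u u')
  then show "\<exists>y\<in>carrier ?G. y \<otimes>\<^bsub>?G\<^esub> x = \<one>\<^bsub>?G\<^esub>" using word_class_carrier[OF u'] by blast
  fix y assume "y \<in> carrier ?G"
  then obtain v where v: "v \<in> words I" and y: "y = word_class I R v" by (rule word_class_cases)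
  show "x \<otimes>\<^bsub>?G\<^esub> y \<in> carrier ?G"
    unfolding x y word_class_mult[OF u v] using u v by (simp add: word_class_carrier)
  fix z assume "z \<in> carrier ?G"
  then obtain w where w: "w \<in> words I" and z: "z = word_class I R w" by (rule word_class_cases)
  show "x \<otimes>\<^bsub>?G\<^esub> y \<otimes>\<^bsub>?G\<^esub> z = x \<otimes>\<^bsub>?G\<^esub> (y \<otimes>\<^bsub>?G\<^esub> z)"
    unfolding x y z using u v w by (simp add: word_class_mult)
qed

text \<open>The universal property of the presented group in the form used below: letters acting on a set
  \<open>X\<close>, with inverse letters acting inversely and relators acting alike, give an action of the
  congruence classes. Applying it to ideals and to signs separately splits the signed action into its
  two parts.\<close>

lemma foldr_pres_cong:
  assumes cong: "(u, v) \<in> pres_cong I R" and "x \<in> X"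
    and closed: "\<And>l x. l \<in> I \<times> UNIV \<Longrightarrow> x \<in> X \<Longrightarrow> f l x \<in> X"
    and inverse: "\<And>i b x. i \<in> I \<Longrightarrow> x \<in> X \<Longrightarrow> f (i, b) (f (i, \<not> b) x) = x"
    and relations: "\<And>r s x. (r, s) \<in> R \<Longrightarrow> r \<in> words I \<Longrightarrow> s \<in> words I \<Longrightarrow> x \<in> X \<Longrightarrow>
      foldr f r x = foldr f s x"
  shows "foldr f u x = foldr f v x"
proof -
  have fold: "foldr f w y \<in> X" if "w \<in> words I" "y \<in> X" for w y
    using that by (induction w) (auto intro: closed)
  show ?thesis
    using cong \<open>x \<in> X\<close>
  proof (induction arbitrary: x rule: pres_cong.induct)
    case (cancel u v i b)
    then show ?case using inverse[of i "foldr f v x" b] fold by simp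
  next
    case (rel u v r s)
    then show ?case using relations[of r s "foldr f v x"] fold by simp
  qed simp_all
qed

section \<open>The Weyl group\<close>

lemma group_weyl_group: "group (weyl_group I a)"
  by (simp add: weyl_group_def group_presented_group)

abbreviation weyl_class :: "'i set \<Rightarrow> ('i \<Rightarrow> 'i \<Rightarrow> int) \<Rightarrow> 'i word \<Rightarrow> 'i word set" where
  "weyl_class I a \<equiv> word_class I (weyl_relations I a)"

lemma weyl_gen_eq: "weyl_gen I a i = weyl_class I a [(i, False)]"
  by (simp add: weyl_gen_def gen_word_def)

lemma weyl_class_mult:
  "u \<in> words I \<Longrightarrow> v \<in> words I \<Longrightarrow>
    weyl_class I a u \<otimes>\<^bsub>weyl_group I a\<^esub> weyl_class I a v = weyl_class I a (u @ v)"
  by (simp add: weyl_group_def word_class_mult)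

lemma weyl_class_carrier: "u \<in> words I \<Longrightarrow> weyl_class I a u \<in> carrier (weyl_group I a)"
  by (simp add: weyl_group_def word_class_carrier)

lemma weyl_class_cases:
  assumes "g \<in> carrier (weyl_group I a)"
  obtains u where "u \<in> words I" "g = weyl_class I a u"
  using assms unfolding weyl_group_def by (rule word_class_cases)

text \<open>Generators of the Weyl group are involutions, so a formal inverse letter represents the same
  element. This is why \<open>toggles\<close> and \<open>word_op\<close> below may ignore the exponents of a word.\<close>

lemma weyl_class_letter:
  assumes "i \<in> I"
  shows "weyl_class I a [(i, b)] = weyl_gen I a i"
proof (cases b)
  case True
  let ?C = "pres_cong I (weyl_relations I a)"
  have "([(i, True)] @ [(i, False), (i, False)] @ [], [(i, True)] @ [] @ []) \<in> ?C"
    by (rule pres_cong.rel) (use assms in \<open>auto simp: weyl_relations_def gen_word_def\<close>)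
  moreover have "([] @ [(i, True), (i, \<not> True)] @ [(i, False)], [] @ [(i, False)]) \<in> ?C"
    by (rule pres_cong.cancel) (use assms in auto)
  ultimately have "([(i, True)], [(i, False)]) \<in> ?C"
    by (auto intro: pres_cong.sym pres_cong.trans)
  then show ?thesis using True assms by (simp add: weyl_gen_eq word_class_eq_iff)
qed (simp add: weyl_gen_eq)

section \<open>The signed action on proper ideals\<close>

context full_heap_over
begin

definition toggles :: "'i word \<Rightarrow> 'e set \<Rightarrow> 'e set" where
  "toggles = foldr (\<lambda>l. toggle (fst l))"

lemma toggles_simps [simp]:
  "toggles [] J = J"
  "toggles (l # u) J = toggle (fst l) (toggles u J)"
  "toggles (u @ v) J = toggles u (toggles v J)"
  by (simp_all add: toggles_def)

lemma toggles_in_ideals: "u \<in> words I \<Longrightarrow> J \<in> ideals \<Longrightarrow> toggles u J \<in> ideals"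
  by (induction u) (auto intro: toggle_in_ideals)

lemma toggles_rev: "u \<in> words I \<Longrightarrow> J \<in> ideals \<Longrightarrow> toggles (rev u) (toggles u J) = J"
proof (induction u arbitrary: J rule: list.induct)
  case (Cons l u)
  then have "toggles u J \<in> ideals" "fst l \<in> I" by (auto intro: toggles_in_ideals)
  with Cons show ?case by (simp add: toggle_toggle)
qed simp

lemma product_cases:
  assumes i: "i \<in> I" and j: "j \<in> I" and "a i j < 0"
  shows "a i j * a j i = 1 \<Longrightarrow> a i j = -1 \<and> a j i = -1"
    and "a i j * a j i = 2 \<Longrightarrow> a i j = -2 \<and> a j i = -1 \<or> a i j = -1 \<and> a j i = -2"
proof -
  have "i \<noteq> j" using diagonal[OF i] \<open>a i j < 0\<close> by auto
  then show "a i j * a j i = 1 \<Longrightarrow> a i j = -1 \<and> a j i = -1"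
    "a i j * a j i = 2 \<Longrightarrow> a i j = -2 \<and> a j i = -1 \<or> a i j = -1 \<and> a j i = -2"
    using off_diagonal[OF i j] off_diagonal[OF j i] by auto
qed

lemma toggles_relation:
  assumes "(r, s) \<in> weyl_relations I a" and J: "J \<in> ideals"
  shows "toggles r J = toggles s J"
proof -
  from assms(1) consider
      (square) i where "i \<in> I" "r = gen_word [i, i]" "s = []"
    | (commute) i j where "i \<in> I" "j \<in> I" "a i j = 0" "r = gen_word [i, j]" "s = gen_word [j, i]"
    | (braid3) i j where "i \<in> I" "j \<in> I" "a i j < 0" "a i j * a j i = 1"
        "r = gen_word [i, j, i]" "s = gen_word [j, i, j]"
    | (braid4) i j where "i \<in> I" "j \<in> I" "a i j < 0" "a i j * a j i = 2"
        "r = gen_word [i, j, i, j]" "s = gen_word [j, i, j, i]"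
    unfolding weyl_relations_def by blast
  then show ?thesis
  proof cases
    case square
    then show ?thesis using toggle_toggle[OF J] by (simp add: gen_word_def)
  next
    case (commute i j)
    then show ?thesis using toggle_commute[OF J commute(1-3)] by (simp add: gen_word_def)
  next
    case (braid3 i j)
    then have "a i j = -1" "a j i = -1" using product_cases(1) by blast+
    from toggle_braid3[OF J braid3(1,2) this] show ?thesis
      using braid3 by (simp add: gen_word_def)
  next
    case (braid4 i j)
    then consider "a i j = -2" "a j i = -1" | "a i j = -1" "a j i = -2"
      using product_cases(2) by blast
    then show ?thesis
    proof cases
      case 1
      from toggle_braid4[OF J braid4(1,2) 1] show ?thesis
        using braid4 by (simp add: gen_word_def)
    next
      case 2
      from toggle_braid4[OF J braid4(2,1) 2(2,1)] show ?thesis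
        using braid4 by (simp add: gen_word_def)
    qed
  qed
qed

lemma toggles_cong:
  assumes "(u, v) \<in> pres_cong I (weyl_relations I a)" "J \<in> ideals"
  shows "toggles u J = toggles v J"
  unfolding toggles_def
proof (rule foldr_pres_cong[OF assms], fold toggles_def)
  show "toggle (fst l) K \<in> ideals" if "l \<in> I \<times> UNIV" "K \<in> ideals" for l K
    using that toggle_in_ideals by auto
qed (simp_all add: toggle_toggle, rule toggles_relation)

lemma sign_cong:
  assumes "(u, v) \<in> pres_cong I (weyl_relations I a)"
  shows "(- 1 :: 'k::ring_1) ^ length u = (- 1) ^ length v"
proof -
  have fold: "foldr (\<lambda>_ c. - c) w 1 = (- 1 :: 'k) ^ length w" for w :: "'i word"
    by (induction w) auto
  have "foldr (\<lambda>_ c. - c) u (1 :: 'k) = foldr (\<lambda>_ c. - c) v 1"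
    by (rule foldr_pres_cong[OF assms, where X = UNIV])
      (auto simp: weyl_relations_def gen_word_def)
  then show ?thesis by (simp add: fold)
qed

text \<open>The product of the operators \<open>- S\<^sub>i\<close> along a word.\<close>

definition word_op :: "'i word \<Rightarrow> ('e set \<Rightarrow>\<^sub>0 'k::field) \<Rightarrow> ('e set \<Rightarrow>\<^sub>0 'k)" where
  "word_op u = linear_extension (\<lambda>J. Poly_Mapping.single (toggles u J) ((- 1) ^ length u))"

lemma word_op_single [simp]:
  "word_op u (Poly_Mapping.single J c) = Poly_Mapping.single (toggles u J) ((- 1) ^ length u * c)"
  by (simp add: word_op_def mult.commute)

lemma word_op_linear [simp]:
  "word_op u 0 = 0"
  "word_op u (v + w) = word_op u v + word_op u w"
  "word_op u (scale c v) = scale c (word_op u v)"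
  by (simp_all add: word_op_def linear_extension_add linear_extension_scale)

lemma word_op_in_heap_space:
  "u \<in> words I \<Longrightarrow> v \<in> heap_space I \<epsilon> \<Longrightarrow> word_op u v \<in> heap_space I \<epsilon>"
  unfolding word_op_def heap_space_def
  by (erule linear_extension_in_free_space) (rule free_space_single, rule toggles_in_ideals)

lemma word_op_Nil [simp]: "word_op [] v = v"
proof -
  have "v \<in> free_space UNIV" by (simp add: free_space_def)
  then show ?thesis by (induction rule: free_space_induct) auto
qed

lemma word_op_append: "word_op (u @ u') v = word_op u (word_op u' v)"
proof -
  have "v \<in> free_space UNIV" by (simp add: free_space_def)
  then show ?thesis
    by (induction rule: free_space_induct) (auto simp: power_add mult.assoc)
qed

lemma word_op_cong:
  assumes "(u, u') \<in> pres_cong I (weyl_relations I a)" "v \<in> heap_space I \<epsilon>"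
  shows "word_op u v = word_op u' v"
  using assms(2) unfolding heap_space_def
  by (induction rule: free_space_induct)
    (simp_all add: toggles_cong[OF assms(1)] sign_cong[OF assms(1)])

lemma word_op_letter:
  assumes "v \<in> heap_space I \<epsilon>" "i \<in> I"
  shows "word_op [(i, b)] v = - S_op \<epsilon> i v"
  using assms(1) unfolding heap_space_def
  by (induction rule: free_space_induct)
    (simp_all add: S_op_def linear_extension_add S_basis_eq assms(2) single_uminus)

definition group_op :: "'i word set \<Rightarrow> ('e set \<Rightarrow>\<^sub>0 'k::field) \<Rightarrow> ('e set \<Rightarrow>\<^sub>0 'k)" where
  "group_op g = word_op (SOME u. u \<in> words I \<and> g = weyl_class I a u)"

lemma group_op_class:
  assumes u: "u \<in> words I" and v: "v \<in> heap_space I \<epsilon>"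
  shows "group_op (weyl_class I a u) v = word_op u v"
proof -
  let ?w = "SOME w. w \<in> words I \<and> weyl_class I a u = weyl_class I a w"
  have "\<exists>w. w \<in> words I \<and> weyl_class I a u = weyl_class I a w" using u by blast
  then have w: "?w \<in> words I \<and> weyl_class I a u = weyl_class I a ?w" by (rule someI_ex)
  have "(?w, u) \<in> pres_cong I (weyl_relations I a)"
    by (rule iffD1[OF word_class_eq_iff[OF conjunct1[OF w] u]]) (rule conjunct2[OF w, symmetric])
  then show ?thesis unfolding group_op_def using v by (rule word_op_cong)
qed

lemma heap_module_exists: "\<exists>act. heap_module I a \<epsilon>
  (act :: ('i word set \<Rightarrow>\<^sub>0 'k::field) \<Rightarrow> ('e set \<Rightarrow>\<^sub>0 'k) \<Rightarrow> ('e set \<Rightarrow>\<^sub>0 'k))"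
proof -
  let ?W = "weyl_group I a" and ?V = "heap_space I \<epsilon> :: ('e set \<Rightarrow>\<^sub>0 'k) set"
  let ?act = "restrict (\<lambda>x. restrict (\<lambda>v. linear_extension (\<lambda>g. group_op g v) x) ?V)
    (carrier (group_algebra ?W)) :: ('i word set \<Rightarrow>\<^sub>0 'k) \<Rightarrow> ('e set \<Rightarrow>\<^sub>0 'k) \<Rightarrow> _"
  interpret W: group ?W by (rule group_weyl_group)
  have "group_algebra_module ?W ?V ?act"
    unfolding heap_space_def
  proof (rule representation_module, fold heap_space_def)
    show "monoid ?W" by (rule W.is_monoid)
  next
    fix g and v :: "'e set \<Rightarrow>\<^sub>0 'k"
    assume "g \<in> carrier ?W" and v: "v \<in> ?V"
    then obtain u where u: "u \<in> words I" "g = weyl_class I a u" by (metis weyl_class_cases)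
    then show "group_op g v \<in> ?V" using v by (simp add: group_op_class word_op_in_heap_space)
  next
    fix g h and v :: "'e set \<Rightarrow>\<^sub>0 'k"
    assume "g \<in> carrier ?W" "h \<in> carrier ?W" and v: "v \<in> ?V"
    then obtain u w where "u \<in> words I" "g = weyl_class I a u" "w \<in> words I" "h = weyl_class I a w"
      by (metis weyl_class_cases)
    then show "group_op (g \<otimes>\<^bsub>?W\<^esub> h) v = group_op g (group_op h v)"
      using v by (simp add: weyl_class_mult group_op_class word_op_in_heap_space word_op_append)
  next
    fix v :: "'e set \<Rightarrow>\<^sub>0 'k"
    assume v: "v \<in> ?V"
    have "\<one>\<^bsub>?W\<^esub> = weyl_class I a []" by (simp add: weyl_group_def word_class_one)
    then show "group_op \<one>\<^bsub>?W\<^esub> v = v" using group_op_class[of "[]" v] v by simp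
  qed (simp_all add: group_op_def)
  moreover have "?act (Poly_Mapping.single (weyl_gen I a i) 1) v = - S_op \<epsilon> i v"
    if "i \<in> I" "v \<in> ?V" for i v
    using that weyl_class_carrier[of "[(i, False)]" I a] group_op_class[of "[(i, False)]" v]
    by (simp add: group_algebra_simps weyl_gen_eq word_op_letter)
  ultimately show ?thesis unfolding heap_module_def by blast
qed

text \<open>In any module structure with the prescribed generators every group element acts by
  \<open>word_op\<close> of a representing word. This gives uniqueness and reduces the other two claims to toggles.\<close>

lemma heap_module_word:
  fixes act :: "('i word set \<Rightarrow>\<^sub>0 'k::field) \<Rightarrow> ('e set \<Rightarrow>\<^sub>0 'k) \<Rightarrow> ('e set \<Rightarrow>\<^sub>0 'k)"
  assumes act: "heap_module I a \<epsilon> act" and "u \<in> words I" and v: "v \<in> heap_space I \<epsilon>"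
  shows "act (Poly_Mapping.single (weyl_class I a u) 1) v = word_op u v"
  using \<open>u \<in> words I\<close>
proof (induction u rule: list.induct)
  case Nil
  have "\<one>\<^bsub>weyl_group I a\<^esub> = weyl_class I a []" by (simp add: weyl_group_def word_class_one)
  then show ?case
    using act v unfolding heap_module_def group_algebra_module_def left_module_def
    by (simp add: group_algebra_simps)
next
  case (Cons l u)
  obtain i b where l: "l = (i, b)" by fastforce
  let ?R = "group_algebra (weyl_group I a) :: ('i word set \<Rightarrow>\<^sub>0 'k) ring"
  let ?x = "Poly_Mapping.single (weyl_class I a [l]) 1 :: 'i word set \<Rightarrow>\<^sub>0 'k"
  let ?y = "Poly_Mapping.single (weyl_class I a u) 1 :: 'i word set \<Rightarrow>\<^sub>0 'k"
  have i: "i \<in> I" and u: "u \<in> words I" using Cons.prems l by auto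
  have "Poly_Mapping.single (weyl_class I a (l # u)) 1 = ?x \<otimes>\<^bsub>?R\<^esub> ?y"
    using weyl_class_mult[of "[l]" I u a] i u l by (simp add: group_algebra_mult_single)
  moreover have "?x \<in> carrier ?R" "?y \<in> carrier ?R"
    using i u l by (simp_all add: group_algebra_simps weyl_class_carrier)
  ultimately have "act (Poly_Mapping.single (weyl_class I a (l # u)) 1) v = act ?x (act ?y v)"
    using act v unfolding heap_module_def group_algebra_module_def left_module_def by metis
  also have "\<dots> = act ?x (word_op u v)" using Cons by simp
  also have "\<dots> = word_op [l] (word_op u v)"
    using act i word_op_in_heap_space[OF u v] l
    by (simp add: heap_module_def weyl_class_letter word_op_letter)
  finally show ?case using word_op_append[of "[l]" u v] by simp
qed

lemma heap_module_unique:
  fixes act act' :: "('i word set \<Rightarrow>\<^sub>0 'k::field) \<Rightarrow> ('e set \<Rightarrow>\<^sub>0 'k) \<Rightarrow> ('e set \<Rightarrow>\<^sub>0 'k)"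
  assumes act: "heap_module I a \<epsilon> act" and act': "heap_module I a \<epsilon> act'"
  shows "act = act'"
proof -
  let ?W = "weyl_group I a" and ?V = "heap_space I \<epsilon> :: ('e set \<Rightarrow>\<^sub>0 'k) set"
  let ?A = "carrier (group_algebra ?W) :: ('i word set \<Rightarrow>\<^sub>0 'k) set"
  have m: "group_algebra_module ?W ?V act" "group_algebra_module ?W ?V act'"
    using act act' by (auto simp: heap_module_def)
  have P: "act \<in> ?A \<rightarrow>\<^sub>E (?V \<rightarrow>\<^sub>E ?V)" "act' \<in> ?A \<rightarrow>\<^sub>E (?V \<rightarrow>\<^sub>E ?V)"
    using m by (auto simp: group_algebra_module_def)
  have W: "monoid ?W" using group_weyl_group by (rule group.is_monoid)
  have single: "act (Poly_Mapping.single g 1) v = act' (Poly_Mapping.single g 1) v"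
    if "g \<in> carrier ?W" "v \<in> ?V" for g v
    using that heap_module_word[OF act] heap_module_word[OF act'] by (metis weyl_class_cases)
  have "act x v = act' x v" if x: "x \<in> ?A" and v: "v \<in> ?V" for x v
  proof -
    have x': "x \<in> free_space (carrier ?W)" using x by (simp add: group_algebra_simps)
    have "linear_extension (\<lambda>g. act (Poly_Mapping.single g 1) v) x =
        linear_extension (\<lambda>g. act' (Poly_Mapping.single g 1) v) x"
      unfolding linear_extension_def
      by (intro sum.cong refl) (use x' single[OF _ v] in \<open>auto simp: free_space_def\<close>)
    then show ?thesis
      using group_algebra_module_linear_extension[OF W m(1) v x']
        group_algebra_module_linear_extension[OF W m(2) v x'] by simp
  qed
  then have "act x = act' x" if "x \<in> ?A" for x
    using that P by (intro PiE_ext[of "act x" ?V "\<lambda>_. ?V" "act' x"]) auto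
  then show ?thesis using P by (intro PiE_ext[of act ?A "\<lambda>_. ?V \<rightarrow>\<^sub>E ?V" act']) auto
qed

section \<open>Sums over rank-two parabolic subgroups\<close>

text \<open>With both entries \<open>-2\<close>, adding an element of label \<open>i\<close> makes one of label \<open>j\<close> addable
  and conversely, without end.\<close>

lemma alternating_step:
  assumes K: "K \<in> ideals" and i: "i \<in> I" and j: "j \<in> I"
    and a: "a i j = -2" "a j i = -2" and w: "weight i K = 1" "weight j K = -1"
  shows "weight i (toggle j (toggle i K)) = 1" "weight j (toggle j (toggle i K)) = -1"
    "K \<subset> toggle j (toggle i K)"
proof -
  let ?K = "toggle i K"
  have K': "?K \<in> ideals" by (rule toggle_in_ideals[OF K i])
  have w': "weight i ?K = -1" "weight j ?K = 1"
    using weight_toggle[OF K i i] weight_toggle[OF K j i] w a diagonal[OF i] by simp_all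
  show "weight i (toggle j ?K) = 1" "weight j (toggle j ?K) = -1"
    using weight_toggle[OF K' i j] weight_toggle[OF K' j j] w' a diagonal[OF j] by simp_all
  show "K \<subset> toggle j ?K"
    using toggle_up(1)[OF K i w(1)] toggle_up(1)[OF K' j w'(2)] bot_out(1)[OF K i] by blast
qed

text \<open>Powers of \<open>s\<^sub>j s\<^sub>i\<close> send \<open>J\<close> to a strictly increasing sequence of ideals, so they are pairwise
  distinct.\<close>

lemma alternating_growth_infinite:
  assumes J: "J \<in> ideals" and i: "i \<in> I" and j: "j \<in> I"
    and a: "a i j = -2" "a j i = -2" and w: "weight i J = 1" "weight j J = -1"
  shows "infinite (generate (weyl_group I a) {weyl_gen I a i, weyl_gen I a j})"
proof
  let ?H = "generate (weyl_group I a) {weyl_gen I a i, weyl_gen I a j}"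
  assume fin: "finite ?H"
  define u where "u n = concat (replicate n [(j, False), (i, False)])" for n
  have u_simps: "u 0 = []" "u (Suc n) = [(j, False)] @ [(i, False)] @ u n" for n
    by (simp_all add: u_def)
  have u: "u n \<in> words I" for n
    by (induction n) (use i j in \<open>auto simp: u_simps\<close>)
  have T: "toggles (u (Suc n)) J = toggle j (toggle i (toggles (u n) J))" for n
    by (simp add: u_simps)
  have inv: "weight i (toggles (u n) J) = 1 \<and> weight j (toggles (u n) J) = -1" for n
  proof (induction n)
    case 0
    show ?case using w by (simp add: u_simps)
  next
    case (Suc n)
    then show ?case
      unfolding T using alternating_step(1,2)[OF toggles_in_ideals[OF u J] i j a] by blast
  qed
  have "toggles (u n) J \<subset> toggles (u (Suc n)) J" for n
    unfolding T using alternating_step(3)[OF toggles_in_ideals[OF u J] i j a] inv by blast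
  then have "strict_mono (\<lambda>n. toggles (u n) J)"
    unfolding strict_mono_Suc_iff by blast
  then have inj: "inj (\<lambda>n. toggles (u n) J)" by (rule strict_mono_imp_inj_on)
  have "inj (\<lambda>n. weyl_class I a (u n))"
  proof (rule injI)
    fix m n assume "weyl_class I a (u m) = weyl_class I a (u n)"
    then have "(u m, u n) \<in> pres_cong I (weyl_relations I a)" by (simp add: word_class_eq_iff u)
    then have "toggles (u m) J = toggles (u n) J" by (rule toggles_cong[OF _ J])
    then show "m = n" by (rule injD[OF inj])
  qed
  moreover have "weyl_class I a (u n) \<in> ?H" for n
  proof (induction n)
    case 0
    have "weyl_class I a [] = \<one>\<^bsub>weyl_group I a\<^esub>" by (simp add: weyl_group_def word_class_one)
    then show ?case by (simp add: u_simps generate.one)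
  next
    case (Suc n)
    have "weyl_class I a (u (Suc n)) = weyl_gen I a j \<otimes>\<^bsub>weyl_group I a\<^esub>
        (weyl_gen I a i \<otimes>\<^bsub>weyl_group I a\<^esub> weyl_class I a (u n))"
      using i j u[of n] by (simp add: u_simps weyl_gen_eq weyl_class_mult)
    then show ?case using Suc by (auto intro: generate.eng generate.incl)
  qed
  ultimately have "finite (UNIV :: nat set)"
    using fin by (metis (no_types, lifting) finite_imageD finite_subset image_subsetI)
  then show False by simp
qed

text \<open>If one of the weights of \<open>J\<close> is \<open>0\<close>, a simple reflection fixes \<open>J\<close>; if a weight becomes \<open>0\<close>
  after one toggle, a conjugate of a simple reflection does. Otherwise all four numbers are \<open>1\<close> or
  \<open>-1\<close>. Equal weights at \<open>i\<close> and \<open>j\<close> would leave the range after one toggle, so they are opposite, and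
  then \<open>weight j (toggle i J)\<close> being \<open>1\<close> or \<open>-1\<close> forces \<open>a\<^sub>j\<^sub>i = -2\<close>; likewise \<open>a\<^sub>i\<^sub>j = -2\<close>. That is
  the case of unlimited growth.\<close>

lemma fixing_reflection:
  assumes J: "J \<in> ideals" and i: "i \<in> I" and j: "j \<in> I" and "i \<noteq> j" "a i j \<noteq> 0"
    and fin: "finite (generate (weyl_group I a) {weyl_gen I a i, weyl_gen I a j})"
  obtains u where "u \<in> lists ({i, j} \<times> UNIV)" "odd (length u)" "toggles u J = J"
proof -
  let ?x = "weight i J" and ?y = "weight j J"
  have J': "toggle i J \<in> ideals" "toggle j J \<in> ideals"
    using J i j by (simp_all add: toggle_in_ideals)
  have w: "weight j (toggle i J) = ?y - a j i * ?x" "weight i (toggle j J) = ?x - a i j * ?y"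
    using weight_toggle[OF J] i j by simp_all
  consider "?x = 0" | "?y = 0" | "weight j (toggle i J) = 0" | "weight i (toggle j J) = 0"
    | "a i j = -2" "a j i = -2" "?x = 1" "?y = -1" | "a i j = -2" "a j i = -2" "?x = -1" "?y = 1"
    using weight_range[OF J i] weight_range[OF J j] weight_range[OF J'(1) j] weight_range[OF J'(2) i]
      off_diagonal[OF i j] off_diagonal[OF j i] zero_sym[OF i j] \<open>i \<noteq> j\<close> \<open>a i j \<noteq> 0\<close>
    unfolding w by auto
  then show ?thesis
  proof cases
    case 1
    then show ?thesis by (intro that[of "[(i, False)]"]) (simp_all add: toggle_fixed)
  next
    case 2
    then show ?thesis by (intro that[of "[(j, False)]"]) (simp_all add: toggle_fixed)
  next
    case 3
    then show ?thesis
      by (intro that[of "[(i, False), (j, False), (i, False)]"])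
        (simp_all add: toggle_fixed toggle_toggle J i)
  next
    case 4
    then show ?thesis
      by (intro that[of "[(j, False), (i, False), (j, False)]"])
        (simp_all add: toggle_fixed toggle_toggle J j)
  next
    case 5
    then show ?thesis using alternating_growth_infinite[OF J i j] fin by simp
  next
    case 6
    then show ?thesis using alternating_growth_infinite[OF J j i] fin by (simp add: insert_commute)
  qed
qed

lemma weyl_class_in_parabolic:
  assumes "S \<subseteq> I" "u \<in> lists (S \<times> UNIV)"
  shows "weyl_class I a u \<in> generate (weyl_group I a) (weyl_gen I a ` S)"
  using assms(2)
proof (induction u rule: list.induct)
  case Nil
  have "weyl_class I a [] = \<one>\<^bsub>weyl_group I a\<^esub>" by (simp add: weyl_group_def word_class_one)
  then show ?case by (simp add: generate.one)
next
  case (Cons l u)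
  obtain i b where l: "l = (i, b)" by fastforce
  have i: "i \<in> S" and u: "u \<in> lists (S \<times> UNIV)" using Cons.prems l by auto
  have "u \<in> words I" by (rule subsetD[OF lists_mono u]) (use assms(1) in auto)
  moreover have "[l] \<in> words I" using i l assms(1) by auto
  ultimately have "weyl_class I a (l # u) = weyl_gen I a i \<otimes>\<^bsub>weyl_group I a\<^esub> weyl_class I a u"
    using weyl_class_mult[of "[l]" I u a] weyl_class_letter[of i I a b] i l assms(1) by auto
  then show ?case using Cons.IH[OF u] i by (auto intro: generate.eng generate.incl)
qed

lemma parabolic_sum_annihilates:
  fixes act :: "('i word set \<Rightarrow>\<^sub>0 'k::field) \<Rightarrow> ('e set \<Rightarrow>\<^sub>0 'k) \<Rightarrow> ('e set \<Rightarrow>\<^sub>0 'k)"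
  assumes char: "CHAR('k) \<noteq> 2" and act: "heap_module I a \<epsilon> act"
    and i: "i \<in> I" and j: "j \<in> I" and "i \<noteq> j" "a i j \<noteq> 0"
    and fin: "finite (generate (weyl_group I a) {weyl_gen I a i, weyl_gen I a j})"
    and v: "v \<in> heap_space I \<epsilon>"
  shows "act (\<Sum>w\<in>generate (weyl_group I a) {weyl_gen I a i, weyl_gen I a j}.
    Poly_Mapping.single w 1) v = 0"
proof -
  let ?W = "weyl_group I a" and ?V = "heap_space I \<epsilon> :: ('e set \<Rightarrow>\<^sub>0 'k) set"
  let ?H = "generate ?W {weyl_gen I a i, weyl_gen I a j}"
  let ?x = "\<Sum>w\<in>?H. Poly_Mapping.single w 1 :: 'i word set \<Rightarrow>\<^sub>0 'k"
  interpret W: group ?W by (rule group_weyl_group)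
  have gens: "{weyl_gen I a i, weyl_gen I a j} \<subseteq> carrier ?W"
    using i j by (auto simp: weyl_gen_eq weyl_class_carrier)
  have H: "subgroup ?H ?W" by (rule W.generate_is_subgroup[OF gens])
  have mod: "group_algebra_module ?W ?V act" using act by (simp add: heap_module_def)
  have x: "?x \<in> carrier (group_algebra ?W)"
    unfolding group_algebra_simps
    by (intro free_space_sum free_space_single) (rule subgroup.mem_carrier[OF H])
  have lin: "act ?x (v + w) = act ?x v + act ?x w" if "v \<in> ?V" "w \<in> ?V" for v w
    using mod that x unfolding group_algebra_module_def left_module_def by blast
  show ?thesis
    using v unfolding heap_space_def
  proof (induction rule: free_space_induct)
    case zero
    have "0 \<in> ?V" by (simp add: heap_space_def)
    from lin[OF this this] show ?case by simp
  next
    case (add v w)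
    then show ?case using lin by (simp add: heap_space_def)
  next
    case (single J c)
    obtain u where u: "u \<in> lists ({i, j} \<times> UNIV)" "odd (length u)" "toggles u J = J"
      using fixing_reflection[OF single i j \<open>i \<noteq> j\<close> \<open>a i j \<noteq> 0\<close> fin] .
    have uI: "u \<in> words I" by (rule subsetD[OF lists_mono u(1)]) (use i j in auto)
    have V: "Poly_Mapping.single J c \<in> ?V" using single by (simp add: heap_space_def)
    show ?case
    proof (rule sum_over_subgroup_annihilates[OF group_weyl_group char mod H _ V])
      show "weyl_class I a u \<in> ?H" using weyl_class_in_parabolic[OF _ u(1)] i j by simp
      show "act (Poly_Mapping.single (weyl_class I a u) 1) (Poly_Mapping.single J c) =
          - Poly_Mapping.single J c"
        using heap_module_word[OF act uI V] u(2,3) by (simp add: single_uminus)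
    qed
  qed
qed

lemma noncommuting_adjacent:
  assumes i: "i \<in> I" and j: "j \<in> I"
    and ne: "weyl_gen I a i \<otimes>\<^bsub>weyl_group I a\<^esub> weyl_gen I a j \<noteq>
      weyl_gen I a j \<otimes>\<^bsub>weyl_group I a\<^esub> weyl_gen I a i"
  shows "i \<noteq> j" "a i j \<noteq> 0"
proof -
  show "i \<noteq> j" using ne by auto
  show "a i j \<noteq> 0"
  proof
    assume "a i j = 0"
    then have "([] @ gen_word [i, j] @ [], [] @ gen_word [j, i] @ []) \<in> pres_cong I (weyl_relations I a)"
      by (intro pres_cong.rel) (use i j in \<open>auto simp: weyl_relations_def gen_word_def\<close>)
    then have "weyl_class I a [(i, False), (j, False)] = weyl_class I a [(j, False), (i, False)]"
      using i j by (subst word_class_eq_iff) (auto simp: gen_word_def)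
    then show False using ne i j by (simp add: weyl_gen_eq weyl_class_mult)
  qed
qed

section \<open>Cyclicity\<close>

lemma ideals_Int:
  assumes J: "J \<in> ideals" and K: "K \<in> ideals"
  shows "J \<inter> K \<in> ideals"
proof -
  have "\<exists>\<alpha>\<in>J \<inter> K. \<epsilon> \<alpha> = p" if p: "p \<in> I" for p
    using top_in(1,2)[OF J p] top_in(1,2)[OF K p] ideal_down[OF J] ideal_down[OF K]
      same_label_comparable[of "top_in p J" "top_in p K"] by (metis IntI)
  moreover have "heap_ideal (J \<inter> K)"
    using ideal_down[OF J] ideal_down[OF K] unfolding heap_ideal_def by blast
  moreover have "\<exists>\<alpha>. \<alpha> \<notin> J \<inter> K \<and> \<epsilon> \<alpha> = p" if p: "p \<in> I" for p
    using bot_out(1,2)[OF J p] by blast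
  ultimately show ?thesis unfolding ideals_iff by blast
qed

text \<open>In each of the finitely many label classes, the difference is confined to an interval.\<close>

lemma finite_ideal_diff:
  assumes J: "J \<in> ideals" and K: "K \<in> ideals"
  shows "finite (J - K)"
proof (rule finite_subset)
  show "J - K \<subseteq> (\<Union>p\<in>I. {top_in p K..top_in p J})"
  proof
    fix \<gamma> assume \<gamma>: "\<gamma> \<in> J - K"
    let ?p = "\<epsilon> \<gamma>"
    have p: "?p \<in> I" by (rule label_in)
    have "\<gamma> \<le> top_in ?p J" using top_in(3)[OF J p] \<gamma> by simp
    moreover have "top_in ?p K \<le> \<gamma>"
      using same_label_comparable[of \<gamma> "top_in ?p K"] top_in(1,2)[OF K p]
        ideal_down[OF K, of "top_in ?p K" \<gamma>] \<gamma> by auto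
    ultimately show "\<gamma> \<in> (\<Union>p\<in>I. {top_in p K..top_in p J})" using p by auto
  qed
  show "finite (\<Union>p\<in>I. {top_in p K..top_in p J})"
    using finite_I finite_interval by blast
qed

text \<open>A maximal element of the finite set \<open>J - K\<close> is maximal in \<open>J\<close>, because \<open>K\<close> is downward closed.
  So it can be removed by toggling its label.\<close>

lemma toggles_descend:
  assumes "J \<in> ideals" "K \<in> ideals" "K \<subseteq> J"
  shows "\<exists>u\<in>words I. toggles u J = K"
  using assms
proof (induction "card (J - K)" arbitrary: J)
  case 0
  then have "J = K" using finite_ideal_diff[of J K] by auto
  then show ?case by (intro bexI[of _ "[]"]) auto
next
  case (Suc n)
  note J = \<open>J \<in> ideals\<close> and K = \<open>K \<in> ideals\<close>
  have fin: "finite (J - K)" by (rule finite_ideal_diff[OF J K])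
  have "J - K \<noteq> {}" using Suc.hyps(2) by force
  then obtain m where m: "m \<in> J - K" and max: "\<And>x. x \<in> J - K \<Longrightarrow> m \<le> x \<Longrightarrow> m = x"
    using finite_has_maximal[OF fin] by metis
  have "\<not> m < x" if "x \<in> J" for x
    using max[of x] that ideal_down[OF K, of x m] m by (auto simp: order.strict_iff_order)
  then have ideal: "heap_ideal (J - {m})"
    using ideal_down[OF J] by (auto simp: heap_ideal_def order.strict_iff_order)
  let ?i = "\<epsilon> m"
  have i: "?i \<in> I" by (rule label_in)
  have "m = top_in ?i J" using removable_unique[OF J _ HOL.refl ideal] m by simp
  then have t: "toggle ?i J = J - {m}"
    using weight_neg_iff[OF J i] ideal by (simp add: toggle_def)
  have "J - {m} - K = J - K - {m}" by auto
  then have "n = card (J - {m} - K)"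
    using Suc.hyps(2) fin m by simp
  moreover have "J - {m} \<in> ideals" by (rule remove_in_ideals[OF J ideal])
  moreover have "K \<subseteq> J - {m}" using \<open>K \<subseteq> J\<close> m by auto
  ultimately obtain u where u: "u \<in> words I" "toggles u (J - {m}) = K"
    using Suc.hyps(1)[of "J - {m}"] K by blast
  have "u @ [(?i, False)] \<in> words I" using u i by auto
  then show ?case by (rule bexI[rotated]) (simp add: u t)
qed

text \<open>Descend from \<open>J\<close> to \<open>J \<inter> K\<close>, and retrace the descent from \<open>K\<close> backwards.\<close>

lemma toggles_transitive:
  assumes J: "J \<in> ideals" and K: "K \<in> ideals"
  obtains u where "u \<in> words I" "toggles u J = K"
proof -
  have JK: "J \<inter> K \<in> ideals" by (rule ideals_Int[OF J K])
  obtain u where u: "u \<in> words I" "toggles u J = J \<inter> K"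
    using toggles_descend[OF J JK] by auto
  obtain v where v: "v \<in> words I" "toggles v K = J \<inter> K"
    using toggles_descend[OF K JK] by auto
  have "toggles (rev v @ u) J = K" using toggles_rev[OF v(1) K] u v by simp
  moreover have "rev v @ u \<in> words I" using u v by auto
  ultimately show ?thesis by (rule that[rotated])
qed

lemma ideal_generates:
  fixes act :: "('i word set \<Rightarrow>\<^sub>0 'k::field) \<Rightarrow> ('e set \<Rightarrow>\<^sub>0 'k) \<Rightarrow> ('e set \<Rightarrow>\<^sub>0 'k)"
  assumes act: "heap_module I a \<epsilon> act" and J: "J \<in> ideals"
  shows "generates_module (group_algebra (weyl_group I a)) (heap_space I \<epsilon>) act (ideal_vec J)"
proof -
  let ?W = "weyl_group I a" and ?V = "heap_space I \<epsilon> :: ('e set \<Rightarrow>\<^sub>0 'k) set"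
  let ?R = "group_algebra ?W :: ('i word set \<Rightarrow>\<^sub>0 'k) ring" and ?v = "ideal_vec J :: 'e set \<Rightarrow>\<^sub>0 'k"
  have mod: "group_algebra_module ?W ?V act" using act by (simp add: heap_module_def)
  have v: "?v \<in> ?V" using J by (simp add: heap_space_def)
  have W: "monoid ?W" using group_weyl_group by (rule group.is_monoid)
  have "\<exists>x\<in>carrier ?R. act x ?v = w" if "w \<in> ?V" for w
    using that unfolding heap_space_def
  proof (induction rule: free_space_induct)
    case zero
    show ?case
      by (rule bexI[of _ 0]) (simp_all add: group_algebra_module_zero[OF mod v] group_algebra_simps)
  next
    case (add w w')
    then obtain x y where "x \<in> carrier ?R" "act x ?v = w" "y \<in> carrier ?R" "act y ?v = w'" by blast
    then show ?case
      by (intro bexI[of _ "x + y"])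
        (simp_all add: group_algebra_module_add[OF mod v] group_algebra_simps free_space_add)
  next
    case (single K c)
    obtain u where u: "u \<in> words I" "toggles u J = K" using toggles_transitive[OF J single] .
    let ?c = "c * (- 1) ^ length u"
    let ?x = "Poly_Mapping.single (weyl_class I a u) ?c :: 'i word set \<Rightarrow>\<^sub>0 'k"
    have "act ?x ?v = scale ?c (act (Poly_Mapping.single (weyl_class I a u) 1) ?v)"
      by (rule group_algebra_module_scale[OF W mod weyl_class_carrier[OF u(1)] v])
    also have "\<dots> = scale ?c (word_op u ?v)" unfolding heap_module_word[OF act u(1) v] ..
    also have "\<dots> = Poly_Mapping.single K c"
      using u(2) by (simp add: mult.assoc flip: power_mult_distrib)
    finally show ?case
      by (rule bexI) (simp add: group_algebra_simps weyl_class_carrier u(1))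
  qed
  moreover have "act x ?v \<in> ?V" if "x \<in> carrier ?R" for x
    using mod v that unfolding group_algebra_module_def left_module_def by blast
  ultimately show ?thesis unfolding generates_module_def using v by fast
qed

lemma heap_module_cyclic:
  fixes act :: "('i word set \<Rightarrow>\<^sub>0 'k::field) \<Rightarrow> ('e set \<Rightarrow>\<^sub>0 'k) \<Rightarrow> ('e set \<Rightarrow>\<^sub>0 'k)"
  assumes act: "heap_module I a \<epsilon> act"
  shows "cyclic_module (group_algebra (weyl_group I a)) (heap_space I \<epsilon>) act"
proof (cases "ideals = {}")
  \<comment> \<open>Without proper ideals the module is zero, and its only vector generates it.\<close>
  case True
  let ?V = "heap_space I \<epsilon> :: ('e set \<Rightarrow>\<^sub>0 'k) set"
  have mod: "group_algebra_module (weyl_group I a) ?V act" using act by (simp add: heap_module_def)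
  have V: "?V = {0}" using True by (auto simp: heap_space_def free_space_def)
  have "act x 0 = 0" if "x \<in> carrier (group_algebra (weyl_group I a))" for x
    using mod that unfolding group_algebra_module_def left_module_def V by blast
  moreover have "0 \<in> carrier (group_algebra (weyl_group I a) :: ('i word set \<Rightarrow>\<^sub>0 'k) ring)"
    by (simp add: group_algebra_simps)
  ultimately have "generates_module (group_algebra (weyl_group I a)) ?V act 0"
    unfolding generates_module_def V by (auto simp: image_iff)
  then show ?thesis unfolding cyclic_module_def by blast
next
  case False
  then show ?thesis using ideal_generates[OF act] unfolding cyclic_module_def by blast
qed

end

theorem proposition8p7:
  fixes I :: "'i set"
    and a :: "'i \<Rightarrow> 'i \<Rightarrow> int"
    and \<epsilon> :: "'e::order \<Rightarrow> 'i"
  assumes "gcm I a"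
    and "simply_folded I a \<epsilon>"
    and "CHAR('k::field) \<noteq> 2"
  shows "(\<exists>!act :: ('i word set \<Rightarrow>\<^sub>0 'k) \<Rightarrow> ('e set \<Rightarrow>\<^sub>0 'k) \<Rightarrow> ('e set \<Rightarrow>\<^sub>0 'k).
      heap_module I a \<epsilon> act) \<and>
    (\<forall>act :: ('i word set \<Rightarrow>\<^sub>0 'k) \<Rightarrow> ('e set \<Rightarrow>\<^sub>0 'k) \<Rightarrow> ('e set \<Rightarrow>\<^sub>0 'k).
      heap_module I a \<epsilon> act \<longrightarrow>
        (\<forall>i\<in>I. \<forall>j\<in>I.
          weyl_gen I a i \<otimes>\<^bsub>weyl_group I a\<^esub> weyl_gen I a j \<noteq>
            weyl_gen I a j \<otimes>\<^bsub>weyl_group I a\<^esub> weyl_gen I a i \<and>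
          finite (generate (weyl_group I a) {weyl_gen I a i, weyl_gen I a j}) \<longrightarrow>
          (\<forall>v\<in>heap_space I \<epsilon>.
            act (\<Sum>w\<in>generate (weyl_group I a) {weyl_gen I a i, weyl_gen I a j}.
                   Poly_Mapping.single w 1) v = 0)) \<and>
        cyclic_module (group_algebra (weyl_group I a)) (heap_space I \<epsilon>) act \<and>
        (\<forall>J\<in>proper_ideals I \<epsilon>.
          generates_module (group_algebra (weyl_group I a)) (heap_space I \<epsilon>) act (ideal_vec J)))"
proof -
  interpret full_heap_over I a \<epsilon>
    using assms(1,2) by unfold_locales (auto simp: simply_folded_def)
  note annihilates = parabolic_sum_annihilates[OF assms(3)]
  show ?thesis
  proof (intro conjI allI impI ballI)
    show "\<exists>!act :: ('i word set \<Rightarrow>\<^sub>0 'k) \<Rightarrow> ('e set \<Rightarrow>\<^sub>0 'k) \<Rightarrow> ('e set \<Rightarrow>\<^sub>0 'k).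
        heap_module I a \<epsilon> act"
      using heap_module_exists heap_module_unique by blast
  next
    fix act :: "('i word set \<Rightarrow>\<^sub>0 'k) \<Rightarrow> ('e set \<Rightarrow>\<^sub>0 'k) \<Rightarrow> ('e set \<Rightarrow>\<^sub>0 'k)"
    assume act: "heap_module I a \<epsilon> act"
    show "cyclic_module (group_algebra (weyl_group I a)) (heap_space I \<epsilon>) act"
      by (rule heap_module_cyclic[OF act])
    show "generates_module (group_algebra (weyl_group I a)) (heap_space I \<epsilon>) act (ideal_vec J)"
      if "J \<in> ideals" for J
      by (rule ideal_generates[OF act that])
    fix i j and v :: "'e set \<Rightarrow>\<^sub>0 'k"
    assume i: "i \<in> I" and j: "j \<in> I" and v: "v \<in> heap_space I \<epsilon>"
      and *: "weyl_gen I a i \<otimes>\<^bsub>weyl_group I a\<^esub> weyl_gen I a j \<noteq>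
        weyl_gen I a j \<otimes>\<^bsub>weyl_group I a\<^esub> weyl_gen I a i \<and>
        finite (generate (weyl_group I a) {weyl_gen I a i, weyl_gen I a j})"
    note adjacent = noncommuting_adjacent[OF i j conjunct1[OF *]]
    show "act (\<Sum>w\<in>generate (weyl_group I a) {weyl_gen I a i, weyl_gen I a j}.
        Poly_Mapping.single w 1) v = 0"
      by (rule annihilates[OF act i j adjacent conjunct2[OF *] v])
  qed
qed

end
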